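(* For $u\in\mathfrak X$ and $v\in\mathfrak X^+$, \[ u\triangleright B(v)=B(u\diamond v). \]
   Context: $\mathfrak X=\mathbb Q\langle x_1,x_2,\dots\rangle$, $\mathfrak X^+$ the span of non-empty monomials. Block shuffle product $\diamond$ on $\mathfrak X$: bilinear with $u\diamond1=1\diamond u=u$, $x_au\diamond x_bv=x_a(u\diamond x_bv)+x_b(x_au\diamond v)-s_{a+b}(u\diamond v)$, where $s_k(x_iw)=x_{i+k}w$, $s_k(1)=0$. $\mathcal A=\mathbb Q\langle e_z\mid z\in\mathbb C\rangle$, $\mathcal A^+$ the span of non-empty words; $\bm\iota$ the automorphism $e_z\mapsto e_{1-z}$; $U(b)$ ($b\ge0$) the sum of the two alternating words of length $b$ in $e_0,e_1$ ($U(0)=2$). The bilinear map $\triangleright:\mathfrak X\times\mathcal A^+\to\mathcal A^+$ is \[ x_{b_1}\cdots x_{b_m}\triangleright e_{a_1}\cdots e_{a_n}=\sum_{d=n}^{n+m}(-1)^{n+m-d}\sum_{(i_1,\dots,i_d,f)\in\mathscr B_d}e_{a_{i_1}}V_1\bm\iota^{s_1}(e_{a_{i_2}})\cdots V_{d-1}\bm\iota^{s_{d-1}}(e_{a_{i_d}}), \] with $\mathscr B_d$ the set of ($1=i_1\le\cdots\le i_d=n$, weakly increasing $f:\{1,\dots,m\}\to\{1,\dots,d-1\}$) such that for all $k$: $i_{k+1}-i_k\le1$ and $i_{k+1}-i_k=1$ if $f^{-1}(k)=\emptyset$; $s_k=\sum_{f(j)\le k}(b_j-1)$; $V_k=1$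 if $f^{-1}(k)=\emptyset$ and $V_k=U(i_{k+1}-i_k-1+\sum_{f(j)=k}b_j)$ otherwise. $B:\mathfrak X^+\to\mathbb Q\langle e_0,e_1\rangle$ is the linear map with $B(x_{b_1}\cdots x_{b_m})=e_{c_1}\cdots e_{c_N}$, $N=b_1+\cdots+b_m$, where $c_1=0$ and $c_{i+1}=c_i$ if $i\in\{b_1,b_1+b_2,\dots,b_1+\cdots+b_{m-1}\}$, $c_{i+1}=1-c_i$ otherwise. *)

theory Defs
  imports Complex_Main "HOL-Library.Poly_Mapping" "HOL-Library.FuncSet"
begin

text \<open>
  Words over an alphabet form a monoid under concatenation.  With this instance, finitely
  supported functions from words to \<open>rat\<close>, with the convolution product from
  \<^theory>\<open>HOL-Library.Poly_Mapping\<close>, are the free associative unital algebra over the rationals.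
\<close>

instantiation list :: (type) monoid_add
begin

definition zero_list :: "'a list" where "zero_list = []"

definition plus_list :: "'a list \<Rightarrow> 'a list \<Rightarrow> 'a list" where "plus_list u v = u @ v"

instance by standard (simp_all add: zero_list_def plus_list_def)

end

type_synonym 'a free_alg = "'a list \<Rightarrow>\<^sub>0 rat"

definition word :: "'a list \<Rightarrow> 'a free_alg" where
  "word w = Poly_Mapping.single w 1"

definition scale :: "rat \<Rightarrow> 'a free_alg \<Rightarrow> 'a free_alg" where
  "scale c p = Poly_Mapping.map ((*) c) p"

definition lin_ext :: "('a list \<Rightarrow> 'b free_alg) \<Rightarrow> 'a free_alg \<Rightarrow> 'b free_alg" where
  "lin_ext g p = (\<Sum>w\<in>Poly_Mapping.keys p. scale (Poly_Mapping.lookup p w) (g w))"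

definition bilin_ext ::
  "('a list \<Rightarrow> 'b list \<Rightarrow> 'c free_alg) \<Rightarrow> 'a free_alg \<Rightarrow> 'b free_alg \<Rightarrow> 'c free_alg" where
  "bilin_ext g p q = lin_ext (\<lambda>u. lin_ext (g u) q) p"

text \<open>
  The letter \<open>x\<^sub>i\<close> is the natural number \<open>i\<close>.  Since the alphabet starts at \<open>x\<^sub>1\<close>, the algebra
  \<open>\<XX>\<close> is the subspace of \<open>nat free_alg\<close> spanned by the words with positive entries;
  the operations below are given by the same formulas on the whole type.
\<close>

definition \<XX> :: "nat free_alg set" where
  "\<XX> = {p. \<forall>w\<in>Poly_Mapping.keys p. \<forall>b\<in>set w. 1 \<le> b}"

definition \<XX>_plus :: "nat free_alg set" where
  "\<XX>_plus = {p \<in> \<XX>. [] \<notin> Poly_Mapping.keys p}"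

fun shift_word :: "nat \<Rightarrow> nat list \<Rightarrow> nat free_alg" where
  "shift_word k [] = 0"
| "shift_word k (i # w) = word ((i + k) # w)"

definition shift :: "nat \<Rightarrow> nat free_alg \<Rightarrow> nat free_alg" where
  "shift k = lin_ext (shift_word k)"

fun block_shuffle_word :: "nat list \<Rightarrow> nat list \<Rightarrow> nat free_alg" where
  "block_shuffle_word u [] = word u"
| "block_shuffle_word [] v = word v"
| "block_shuffle_word (a # u) (b # v) =
     word [a] * block_shuffle_word u (b # v)
     + word [b] * block_shuffle_word (a # u) v
     - shift (a + b) (block_shuffle_word u v)"

definition block_shuffle :: "nat free_alg \<Rightarrow> nat free_alg \<Rightarrow> nat free_alg"
    (infixl "\<diamondop>" 70) where
  "u \<diamondop> v = bilin_ext block_shuffle_word u v"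

text \<open>The letter \<open>e\<^sub>z\<close> is the complex number \<open>z\<close>, so \<open>\<A>\<close> is \<open>complex free_alg\<close>.\<close>

definition iota :: "complex free_alg \<Rightarrow> complex free_alg" where
  "iota = lin_ext (\<lambda>w. word (map (\<lambda>z. 1 - z) w))"

definition U :: "nat \<Rightarrow> complex free_alg" where
  "U b = word (map (\<lambda>i. if even i then 0 else 1) [0..<b])
       + word (map (\<lambda>i. if even i then 1 else 0) [0..<b])"

text \<open>
  \<open>index_set n m d\<close> is the set \<open>\<B>\<^sub>d\<close>.  The sequence \<open>i\<^sub>1, \<dots>, i\<^sub>d\<close> is an extensional function on
  \<open>{1..d}\<close>, and \<open>f\<close> is extensional on \<open>{1..m}\<close>, so that each element is counted once.
\<close>

definition index_set :: "nat \<Rightarrow> nat \<Rightarrow> nat \<Rightarrow> ((nat \<Rightarrow> nat) \<times> (nat \<Rightarrow> nat)) set" where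
  "index_set n m d = {(i, f).
     i \<in> {1..d} \<rightarrow>\<^sub>E {1..n} \<and> mono_on {1..d} i \<and> i 1 = 1 \<and> i d = n \<and>
     f \<in> {1..m} \<rightarrow>\<^sub>E {1..d - 1} \<and> mono_on {1..m} f \<and>
     (\<forall>k\<in>{1..d - 1}. i (k + 1) \<le> i k + 1 \<and>
        ({j \<in> {1..m}. f j = k} = {} \<longrightarrow> i (k + 1) = i k + 1))}"

text \<open>
  Below, \<open>b\<^sub>j\<close> is \<open>bs ! (j - 1)\<close> and \<open>a\<^sub>i\<close> is \<open>as ! (i - 1)\<close>.  In \<open>V_factor\<close> the subtractions come
  last: \<open>i\<^sub>k\<^sub>+\<^sub>1 - i\<^sub>k - 1\<close> alone may be \<open>-1\<close>, but it is only used together with a nonempty sum of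
  positive \<open>b\<^sub>j\<close>.
\<close>

definition s_exp :: "nat list \<Rightarrow> (nat \<Rightarrow> nat) \<Rightarrow> nat \<Rightarrow> nat" where
  "s_exp bs f k = (\<Sum>j\<in>{j \<in> {1..length bs}. f j \<le> k}. bs ! (j - 1) - 1)"

definition V_factor ::
  "nat list \<Rightarrow> (nat \<Rightarrow> nat) \<Rightarrow> (nat \<Rightarrow> nat) \<Rightarrow> nat \<Rightarrow> complex free_alg" where
  "V_factor bs i f k =
     (let J = {j \<in> {1..length bs}. f j = k} in
      if J = {} then 1
      else U (i (k + 1) + (\<Sum>j\<in>J. bs ! (j - 1)) - i k - 1))"

text \<open>Only used for nonempty \<open>as\<close>; the formula has no meaning for the empty word.\<close>

definition triangle_word :: "nat list \<Rightarrow> complex list \<Rightarrow> complex free_alg" where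
  "triangle_word bs as =
     (let m = length bs; n = length as in
      \<Sum>d = n..n + m. (- 1) ^ (n + m - d) *
        (\<Sum>(i, f)\<in>index_set n m d.
           word [as ! (i 1 - 1)] *
           prod_list (map (\<lambda>k. V_factor bs i f k *
             (iota ^^ s_exp bs f k) (word [as ! (i (k + 1) - 1)])) [1..<d])))"

definition triangle :: "nat free_alg \<Rightarrow> complex free_alg \<Rightarrow> complex free_alg"
    (infixr "\<triangleright>" 70) where
  "u \<triangleright> w = bilin_ext triangle_word u w"

definition cut_points :: "nat list \<Rightarrow> nat set" where
  "cut_points bs = {sum_list (take j bs) | j. 1 \<le> j \<and> j \<le> length bs - 1}"

text \<open>\<open>block_letter bs i\<close> is \<open>c\<^sub>i\<close> for \<open>i \<ge> 1\<close>; the value at \<open>0\<close> is unused.\<close>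

fun block_letter :: "nat list \<Rightarrow> nat \<Rightarrow> complex" where
  "block_letter bs 0 = 0"
| "block_letter bs (Suc 0) = 0"
| "block_letter bs (Suc (Suc i)) =
     (if Suc i \<in> cut_points bs then block_letter bs (Suc i) else 1 - block_letter bs (Suc i))"

text \<open>
  The values lie in the subalgebra generated by \<open>e\<^sub>0\<close> and \<open>e\<^sub>1\<close>.  The map is meant on \<open>\<XX>_plus\<close>,
  which contains \<open>u \<diamondop> v\<close> for \<open>u\<close> in \<open>\<XX>\<close> and \<open>v\<close> in \<open>\<XX>_plus\<close>.
\<close>

definition B_map :: "nat free_alg \<Rightarrow> complex free_alg" where
  "B_map = lin_ext (\<lambda>bs. word (map (block_letter bs) [1..<sum_list bs + 1]))"

end

theory Submission
  imports Defs
begin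

text \<open>
  Splitting the sum defining \<open>\<triangleright>\<close> according to its first gap gives a recursion, in which the first
  gap consumes an arbitrary prefix of the word in \<open>\<XX>\<close>.  On words in \<open>e\<^sub>0, e\<^sub>1\<close> the two alternating
  words in \<open>U(b)\<close> behave oppositely with respect to the letter \<open>e\<^sub>c\<close> that follows, and the alternating
  sum over the prefixes telescopes to
  \[ x_a u \triangleright e_c w = e_c (x_a u \triangleright w)
      + A_c(a)\, \iota^{a-1}(u \triangleright e_c w) - A_c(a+1)\, \iota^{a-1}(u \triangleright w), \]
  where \<open>A\<^sub>c(a)\<close> is the alternating word of length \<open>a\<close> starting with \<open>e\<^sub>c\<close>.  Iterating this along
  an alternating word of length \<open>b\<close> yields the image under \<open>B\<close> of the recursion for
  \<open>x\<^sub>a u \<diamondop> x\<^sub>b v\<close>.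
\<close>

subsection \<open>Linear extension\<close>

lemma word_mult: "word u * word v = word (u @ v)"
  by (simp add: word_def mult_single plus_list_def)

lemma word_Nil: "word [] = 1"
  by (simp add: word_def single_one flip: zero_list_def)

lemma word_mult_assoc: "word u * (word v * p) = word (u @ v) * p"
  by (simp add: word_mult flip: mult.assoc)

lemma lookup_scale: "Poly_Mapping.lookup (scale c p) w = c * Poly_Mapping.lookup p w"
  by (simp add: scale_def Poly_Mapping.map.rep_eq when_def)

lemma keys_word: "Poly_Mapping.keys (word w) = {w}"
  by (simp add: word_def)

lemma scale_add_right: "scale c (p + q) = scale c p + scale c q"
  by (rule poly_mapping_eqI) (simp add: lookup_scale lookup_add algebra_simps)

lemma scale_add_left: "scale (c + d) p = scale c p + scale d p"
  by (rule poly_mapping_eqI) (simp add: lookup_scale lookup_add algebra_simps)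

lemma scale_0_left: "scale 0 p = 0"
  by (rule poly_mapping_eqI) (simp add: lookup_scale)

lemma scale_0_right: "scale c 0 = 0"
  by (rule poly_mapping_eqI) (simp add: lookup_scale)

lemma scale_1: "scale 1 p = p"
  by (rule poly_mapping_eqI) (simp add: lookup_scale)

lemma scale_mult: "scale c (scale d p) = scale (c * d) p"
  by (rule poly_mapping_eqI) (simp add: lookup_scale)

lemma scale_minus_left: "scale (- c) p = - scale c p"
  by (rule poly_mapping_eqI) (simp add: lookup_scale)

lemma scale_sum: "scale c (sum f A) = (\<Sum>x\<in>A. scale c (f x))"
  by (induction A rule: infinite_finite_induct) (auto simp: scale_0_right scale_add_right)

lemma word_mult_scale: "word u * scale c p = scale c (word u * p)"
proof -
  \<comment> \<open>Scaling is left multiplication by a multiple of the empty word, the neutral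
    element of the word monoid; hence it passes through \<open>word u\<close>.\<close>
  have s: "scale c q = Poly_Mapping.single 0 c * q" for q :: "'a free_alg"
    by (simp add: scale_def mult_map_scale_conv_mult)
  show ?thesis
    by (simp add: s word_def mult_single flip: mult.assoc)
qed

lemma lin_ext_superset:
  assumes "finite S" "Poly_Mapping.keys p \<subseteq> S"
  shows "lin_ext g p = (\<Sum>w\<in>S. scale (Poly_Mapping.lookup p w) (g w))"
  unfolding lin_ext_def
  by (rule sum.mono_neutral_left) (use assms in \<open>auto simp: in_keys_iff scale_0_left\<close>)

lemma lin_ext_word: "lin_ext g (word w) = g w"
  by (simp add: lin_ext_def keys_word) (simp add: word_def scale_1)

lemma lin_ext_zero: "lin_ext g 0 = 0"
  by (simp add: lin_ext_def)

lemma lin_ext_add: "lin_ext g (p + q) = lin_ext g p + lin_ext g q"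
proof -
  let ?S = "Poly_Mapping.keys p \<union> Poly_Mapping.keys q"
  have "lin_ext g r = (\<Sum>w\<in>?S. scale (Poly_Mapping.lookup r w) (g w))"
    if "Poly_Mapping.keys r \<subseteq> ?S" for r
    using that by (intro lin_ext_superset) auto
  from this[of "p + q"] this[of p] this[of q] show ?thesis
    by (simp add: Poly_Mapping.keys_add lookup_add scale_add_left sum.distrib)
qed

lemma lin_ext_minus: "lin_ext g (- p) = - lin_ext g p"
  by (simp add: lin_ext_def scale_minus_left sum_negf)

lemma lin_ext_diff: "lin_ext g (p - q) = lin_ext g p - lin_ext g q"
  using lin_ext_add[of g p "- q"] by (simp add: lin_ext_minus)

lemma lin_ext_scale: "lin_ext g (scale c p) = scale c (lin_ext g p)"
proof -
  have "Poly_Mapping.keys (scale c p) \<subseteq> Poly_Mapping.keys p"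
    by (auto simp: in_keys_iff lookup_scale)
  then have "lin_ext g (scale c p) =
      (\<Sum>w\<in>Poly_Mapping.keys p. scale (Poly_Mapping.lookup (scale c p) w) (g w))"
    by (intro lin_ext_superset) auto
  then show ?thesis
    by (simp add: lin_ext_def scale_sum scale_mult lookup_scale)
qed

lemma lin_ext_sum: "lin_ext g (sum f A) = (\<Sum>x\<in>A. lin_ext g (f x))"
  by (induction A rule: infinite_finite_induct) (auto simp: lin_ext_zero lin_ext_add)

lemma lin_ext_lin_ext: "lin_ext g (lin_ext h p) = lin_ext (\<lambda>w. lin_ext g (h w)) p"
  unfolding lin_ext_def[of h] lin_ext_def[of "\<lambda>w. lin_ext g (h w)"]
  by (simp add: lin_ext_sum lin_ext_scale)

lemma lin_ext_cong:
  "(\<And>w. w \<in> Poly_Mapping.keys p \<Longrightarrow> g w = h w) \<Longrightarrow> lin_ext g p = lin_ext h p"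
  by (simp add: lin_ext_def)

lemma word_mult_lin_ext: "word u * lin_ext g p = lin_ext (\<lambda>w. word u * g w) p"
  by (simp add: lin_ext_def sum_distrib_left word_mult_scale)

lemma lin_ext_of_word: "lin_ext word p = p"
proof (rule poly_mapping_eqI)
  fix w
  have "Poly_Mapping.lookup (lin_ext word p) w =
    (\<Sum>v\<in>Poly_Mapping.keys p. Poly_Mapping.lookup p v * (1 when v = w))"
    by (simp add: lin_ext_def lookup_sum lookup_scale word_def lookup_single)
  also have "\<dots> = (\<Sum>v\<in>Poly_Mapping.keys p. if v = w then Poly_Mapping.lookup p v else 0)"
    by (rule sum.cong) (auto simp: when_def)
  also have "\<dots> = Poly_Mapping.lookup p w"
    by (simp add: in_keys_iff)
  finally show "Poly_Mapping.lookup (lin_ext word p) w = Poly_Mapping.lookup p w" .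
qed

subsection \<open>Alternating words and block words\<close>

text \<open>The k-fold iterate of \<iota> on a single letter; only the parity of the exponent
  matters.\<close>

definition flip :: "nat \<Rightarrow> complex \<Rightarrow> complex" where
  "flip k z = (if even k then z else 1 - z)"

lemma flip_flip: "flip a (flip b z) = flip (a + b) z"
  by (auto simp: flip_def)

lemma flip_0 [simp]: "flip 0 z = z"
  by (simp add: flip_def)

lemma flip_Suc: "flip (Suc k) z = 1 - flip k z"
  by (auto simp: flip_def)

lemma flip_minus: "flip k (1 - z) = 1 - flip k z"
  by (auto simp: flip_def)

lemma map_flip_flip: "map (flip a) (map (flip b) w) = map (flip (a + b)) w"
  by (simp add: flip_flip)

lemma map_flip_0 [simp]: "map (flip 0) w = w"
  by (simp add: map_idI)

lemma flip_in: "c \<in> {0, 1} \<Longrightarrow> flip k c \<in> {0, 1}"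
  by (auto simp: flip_def)

fun alt :: "complex \<Rightarrow> nat \<Rightarrow> complex list" where
  "alt c 0 = []"
| "alt c (Suc k) = c # alt (1 - c) k"

lemma length_alt [simp]: "length (alt c k) = k"
  by (induction k arbitrary: c) auto

lemma alt_add: "alt c (a + b) = alt c a @ alt (flip a c) b"
  by (induction a arbitrary: c) (auto simp: flip_Suc flip_minus)

lemma alt_Suc_right: "alt c (Suc k) = alt c k @ [flip k c]"
  using alt_add[of c k 1] by simp

lemma map_flip_alt: "map (flip k) (alt c n) = alt (flip k c) n"
  by (induction n arbitrary: c) (auto simp: flip_minus)

lemma alt_conv_upt: "alt c n = map (\<lambda>i. flip i c) [0..<n]"
  by (induction n) (simp_all add: alt_Suc_right del: alt.simps(2))

lemma U_alt: "U n = word (alt 0 n) + word (alt 1 n)"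
  by (simp add: U_def alt_conv_upt flip_def cong: if_cong)

text \<open>For such c the two first letters are 0 and 1 in some order, so the two words of
  \<open>U n\<close> can be named relative to the letter that follows.\<close>

lemma U_alt_flip:
  assumes "c \<in> {0, 1}"
  shows "U n = word (alt (flip k c) n) + word (alt (flip (Suc k) c) n)"
  using assms by (auto simp: U_alt flip_def)

text \<open>\<open>blocks c bs\<close> is \<open>B(x\<^sub>b\<^sub>1 \<cdots> x\<^sub>b\<^sub>m)\<close> with first letter \<open>c\<close> instead of \<open>0\<close>.\<close>

fun blocks :: "complex \<Rightarrow> nat list \<Rightarrow> complex list" where
  "blocks c [] = []"
| "blocks c (b # bs) = alt c b @ blocks (flip (b - 1) c) bs"

lemma map_flip_blocks: "map (flip k) (blocks c bs) = blocks (flip k c) bs"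
  by (induction bs arbitrary: c) (auto simp: map_flip_alt flip_flip add.commute)

lemma blocks_neq_Nil: "0 < b \<Longrightarrow> blocks c (b # bs) \<noteq> []"
  by (cases b) auto

lemma length_blocks: "length (blocks c bs) = sum_list bs"
  by (induction bs arbitrary: c) auto

subsection \<open>Splitting off the first gap\<close>

text \<open>
  The elements of \<open>\<B>\<^sub>d\<close> with the gaps before the \<open>k\<close>-th one deleted: these have consumed
  \<open>a\<^sub>1, \<dots>, a\<^sub>p\<close> and \<open>b\<^sub>1, \<dots>, b\<^sub>q\<close>.  The indices keep their original values, so that
  deleting one more gap is a restriction of \<open>i\<close> and \<open>f\<close>, without any shift.
\<close>

definition gap_set :: "nat \<Rightarrow> nat \<Rightarrow> nat \<Rightarrow> nat \<Rightarrow> nat \<Rightarrow> nat \<Rightarrow> ((nat \<Rightarrow> nat) \<times> (nat \<Rightarrow> nat)) set" where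
  "gap_set n m d k p q = {(i, f).
     i \<in> {k..d} \<rightarrow>\<^sub>E {1..n} \<and> mono_on {k..d} i \<and> i k = p \<and> i d = n \<and>
     f \<in> {q<..m} \<rightarrow>\<^sub>E {k..<d} \<and> mono_on {q<..m} f \<and>
     (\<forall>l\<in>{k..<d}. i (l + 1) \<le> i l + 1 \<and>
        ({j \<in> {q<..m}. f j = l} = {} \<longrightarrow> i (l + 1) = i l + 1))}"

lemma finite_gap_set: "finite (gap_set n m d k p q)"
proof (rule finite_subset)
  show "gap_set n m d k p q \<subseteq> ({k..d} \<rightarrow>\<^sub>E {1..n}) \<times> ({q<..m} \<rightarrow>\<^sub>E {k..<d})"
    by (auto simp: gap_set_def)
qed (auto intro!: finite_PiE)

lemma index_set_conv_gap_set: "index_set n m d = gap_set n m d 1 1 0"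
proof -
  have e: "{Suc 0..m} = {0<..m}" for m
    by auto
  have e2: "{0<..d - Suc 0} = {Suc 0..<d}"
    by auto
  show ?thesis
    unfolding index_set_def gap_set_def by (simp add: e e2)
qed

text \<open>By monotonicity the least admissible value is taken on an initial segment, so this fibre
  is determined by its size: the number of letters consumed by the first gap.\<close>

lemma mono_first_fibre:
  fixes f :: "nat \<Rightarrow> nat"
  assumes "mono_on {q<..m} f" "\<forall>x\<in>{q<..m}. k \<le> f x"
  shows "{x \<in> {q<..m}. f x = k} = {q<..q + card {x \<in> {q<..m}. f x = k}}"
proof (cases "{x \<in> {q<..m}. f x = k} = {}")
  case True
  then show ?thesis by (simp only: card.empty) simp
next
  case False
  let ?J = "{x \<in> {q<..m}. f x = k}"
  have fin: "finite ?J" by simp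
  have M: "Max ?J \<in> ?J" using Max_in[OF fin False] .
  have "?J = {q<..Max ?J}"
  proof (intro equalityI subsetI)
    fix x assume x: "x \<in> {q<..Max ?J}"
    then have "f x \<le> f (Max ?J)"
      using M by (intro mono_onD[OF assms(1)]) auto
    then show "x \<in> ?J"
      using x M assms(2) by (auto intro!: antisym)
  qed (use fin in auto)
  moreover from this have "card ?J = Max ?J - q"
    by (metis card_greaterThanAtMost)
  ultimately show ?thesis
    using M by (metis (no_types, lifting) greaterThanAtMost_iff le_add_diff_inverse less_imp_le mem_Collect_eq)
qed

text \<open>Reinserts the deleted gap k; \<open>glue_f\<close> does the same for f by assigning the
  next j positions to k.\<close>

definition glue_i :: "nat \<Rightarrow> nat \<Rightarrow> (nat \<Rightarrow> nat) \<Rightarrow> nat \<Rightarrow> nat" where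
  "glue_i k p i = i(k := p)"

definition glue_f :: "nat \<Rightarrow> nat \<Rightarrow> nat \<Rightarrow> (nat \<Rightarrow> nat) \<Rightarrow> nat \<Rightarrow> nat" where
  "glue_f k q j f = (\<lambda>x. if x \<in> {q<..q + j} then k else f x)"

text \<open>The inserted values do not exceed the later ones, which preserves monotonicity; the
  condition on j and e says that a gap not hit by f must advance. The second claim recovers j from
  the glued function.\<close>

lemma glue_in_gap_set:
  assumes "k < d" "(i, f) \<in> gap_set n m d (Suc k) (p + e) (q + j)" "1 \<le> p" "e \<le> 1" "q + j \<le> m" "j \<noteq> 0 \<or> e \<noteq> 0"
  shows "(glue_i k p i, glue_f k q j f) \<in> gap_set n m d k p q"
    and "{x \<in> {q<..m}. glue_f k q j f x = k} = {q<..q + j}"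
proof -
  have i: "i \<in> {Suc k..d} \<rightarrow>\<^sub>E {1..n}" "mono_on {Suc k..d} i" "i (Suc k) = p + e" "i d = n"
    and f: "f \<in> {q + j<..m} \<rightarrow>\<^sub>E {Suc k..<d}" "mono_on {q + j<..m} f"
    and g: "\<And>l. l \<in> {Suc k..<d} \<Longrightarrow> i (l + 1) \<le> i l + 1"
      "\<And>l. l \<in> {Suc k..<d} \<Longrightarrow> {x \<in> {q + j<..m}. f x = l} = {} \<Longrightarrow> i (l + 1) = i l + 1"
    using assms(2) by (auto simp: gap_set_def)
  have fk: "Suc k \<le> f x" "f x < d" if "x \<in> {q + j<..m}" for x
    using f(1) that by (auto dest: PiE_mem)
  have ik: "i x \<le> n" "1 \<le> i x" if "x \<in> {Suc k..d}" for x
    using i(1) that by (auto dest: PiE_mem)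
  have fu: "f x = undefined" if "x \<notin> {q + j<..m}" for x
    using f(1) that by (rule PiE_arb)
  have iu: "i x = undefined" if "x \<notin> {Suc k..d}" for x
    using i(1) that by (rule PiE_arb)
  have "glue_f k q j f x = k \<longleftrightarrow> x \<in> {q<..q + j}" if "x \<in> {q<..m}" for x
    using fk[of x] that by (auto simp: glue_f_def)
  then show fib: "{x \<in> {q<..m}. glue_f k q j f x = k} = {q<..q + j}"
    using assms(5) by auto
  have fibl: "{x \<in> {q<..m}. glue_f k q j f x = l} = {x \<in> {q + j<..m}. f x = l}" if "k < l" for l
    using that by (auto simp: glue_f_def)
  have "glue_i k p i \<in> {k..d} \<rightarrow>\<^sub>E {1..n}"
  proof (rule PiE_I)
    fix x assume "x \<in> {k..d}"
    then show "glue_i k p i x \<in> {1..n}"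
      using ik[of x] ik[of "Suc k"] i(3) assms(1,3) by (cases "x = k") (auto simp: glue_i_def)
  next
    fix x assume "x \<notin> {k..d}"
    then show "glue_i k p i x = undefined"
      using iu[of x] assms(1) by (auto simp: glue_i_def)
  qed
  moreover have "mono_on {k..d} (glue_i k p i)"
  proof (rule mono_onI)
    fix x y assume xy: "x \<in> {k..d}" "y \<in> {k..d}" "x \<le> y"
    show "glue_i k p i x \<le> glue_i k p i y"
    proof (cases "x = k")
      case True
      then show ?thesis
        using xy mono_onD[OF i(2), of "Suc k" y] i(3) assms(1) by (cases "y = k") (auto simp: glue_i_def)
    next
      case False
      then show ?thesis
        using xy mono_onD[OF i(2), of x y] by (auto simp: glue_i_def)
    qed
  qed
  moreover have "glue_f k q j f \<in> {q<..m} \<rightarrow>\<^sub>E {k..<d}"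
  proof (rule PiE_I)
    fix x assume "x \<in> {q<..m}"
    then show "glue_f k q j f x \<in> {k..<d}"
      using fk[of x] assms(1) by (auto simp: glue_f_def)
  next
    fix x assume "x \<notin> {q<..m}"
    then show "glue_f k q j f x = undefined"
      using fu[of x] assms(5) by (auto simp: glue_f_def)
  qed
  moreover have "mono_on {q<..m} (glue_f k q j f)"
  proof (rule mono_onI)
    fix x y assume xy: "x \<in> {q<..m}" "y \<in> {q<..m}" "x \<le> y"
    show "glue_f k q j f x \<le> glue_f k q j f y"
      using xy fk[of y] mono_onD[OF f(2), of x y] by (auto simp: glue_f_def)
  qed
  moreover have "glue_i k p i (l + 1) \<le> glue_i k p i l + 1 \<and>
        ({x \<in> {q<..m}. glue_f k q j f x = l} = {} \<longrightarrow> glue_i k p i (l + 1) = glue_i k p i l + 1)"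
    if "l \<in> {k..<d}" for l
  proof (cases "l = k")
    case True
    then show ?thesis
      unfolding True fib using assms(4,6) i(3) by (auto simp: glue_i_def)
  next
    case False
    then have "k < l" using that by auto
    then show ?thesis
      unfolding fibl[OF \<open>k < l\<close>] using g[of l] that by (auto simp: glue_i_def)
  qed
  ultimately show "(glue_i k p i, glue_f k q j f) \<in> gap_set n m d k p q"
    using assms(1) i(4) by (auto simp: gap_set_def glue_i_def)
qed

text \<open>The inverse of gluing: j is the size of the first fibre and e the first
  increment.\<close>

lemma cut_in_gap_set:
  assumes "k < d" "(i, f) \<in> gap_set n m d k p q" "q \<le> m"
  defines "j \<equiv> card {x \<in> {q<..m}. f x = k}" and "e \<equiv> i (Suc k) - p"
  defines "i' \<equiv> restrict i {Suc k..d}" and "f' \<equiv> restrict f {q + j<..m}"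
  shows "(i', f') \<in> gap_set n m d (Suc k) (p + e) (q + j)"
    "e \<le> 1" "q + j \<le> m" "j \<noteq> 0 \<or> e \<noteq> 0" "p + e \<le> n" "glue_i k p i' = i" "glue_f k q j f' = f"
proof -
  have i: "i \<in> {k..d} \<rightarrow>\<^sub>E {1..n}" "mono_on {k..d} i" "i k = p" "i d = n"
    and f: "f \<in> {q<..m} \<rightarrow>\<^sub>E {k..<d}" "mono_on {q<..m} f"
    and g: "\<And>l. l \<in> {k..<d} \<Longrightarrow> i (l + 1) \<le> i l + 1"
      "\<And>l. l \<in> {k..<d} \<Longrightarrow> {x \<in> {q<..m}. f x = l} = {} \<Longrightarrow> i (l + 1) = i l + 1"
    using assms(2) by (auto simp: gap_set_def)
  have fk: "k \<le> f x" "f x < d" if "x \<in> {q<..m}" for x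
    using f(1) that by (auto dest: PiE_mem)
  have fib: "{x \<in> {q<..m}. f x = k} = {q<..q + j}"
    unfolding j_def by (rule mono_first_fibre) (use f(2) fk in auto)
  have "j \<le> card {q<..m}"
    unfolding j_def by (rule card_mono) auto
  then show qj: "q + j \<le> m" using assms(3) by simp
  \<comment> \<open>Monotonicity gives p \<le> \<open>i (Suc k)\<close>, so the subtraction defining
    e is not truncated.\<close>
  have pe: "i (Suc k) = p + e"
    using mono_onD[OF i(2), of k "Suc k"] assms(1) i(3) by (simp add: e_def)
  show "e \<le> 1" using g(1)[of k] assms(1) i(3) pe by simp
  show "j \<noteq> 0 \<or> e \<noteq> 0"
  proof (rule ccontr)
    assume "\<not> (j \<noteq> 0 \<or> e \<noteq> 0)"
    then have none: "{x \<in> {q<..m}. f x = k} = {}" "e = 0"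
      unfolding fib by auto
    then show False
      using g(2)[OF _ none(1)] assms(1) i(3) pe by simp
  qed
  have "i (Suc k) \<in> {1..n}"
    by (rule PiE_mem[OF i(1)]) (use assms(1) in auto)
  then show "p + e \<le> n" using pe by simp
  have fk': "Suc k \<le> f x" if "x \<in> {q + j<..m}" for x
  proof -
    have "x \<notin> {x \<in> {q<..m}. f x = k}" unfolding fib using that by auto
    then have "f x \<noteq> k" using that by auto
    then show ?thesis using fk(1)[of x] that by auto
  qed
  have fibl: "{x \<in> {q + j<..m}. f' x = l} = {x \<in> {q<..m}. f x = l}" if "k < l" for l
  proof -
    have "x \<in> {q + j<..m}" if "x \<in> {q<..m}" "f x = l" for x
    proof -
      have "x \<notin> {q<..q + j}" unfolding fib[symmetric] using that \<open>k < l\<close> by auto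
      then show ?thesis using that by auto
    qed
    then show ?thesis by (auto simp: f'_def)
  qed
  show "(i', f') \<in> gap_set n m d (Suc k) (p + e) (q + j)"
    unfolding gap_set_def mem_Collect_eq prod.case
  proof (intro conjI ballI)
    show "i' \<in> {Suc k..d} \<rightarrow>\<^sub>E {1..n}"
      using i(1) by (auto simp: i'_def dest: PiE_mem)
    show "mono_on {Suc k..d} i'"
      using i(2) by (auto simp: mono_on_def i'_def)
    show "f' \<in> {q + j<..m} \<rightarrow>\<^sub>E {Suc k..<d}"
      using fk fk' by (auto simp: f'_def)
    show "mono_on {q + j<..m} f'"
      using f(2) by (auto simp: mono_on_def f'_def)
    fix l assume l: "l \<in> {Suc k..<d}"
    show "i' (l + 1) \<le> i' l + 1"
      using g(1)[of l] l by (auto simp: i'_def)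
    show "{x \<in> {q + j<..m}. f' x = l} = {} \<longrightarrow> i' (l + 1) = i' l + 1"
      using g(2)[of l] l fibl[of l] by (auto simp: i'_def)
  qed (use pe i(4) assms(1) in \<open>auto simp: i'_def\<close>)
  show "glue_i k p i' = i"
  proof
    fix x
    show "glue_i k p i' x = i x"
      using PiE_arb[OF i(1), of x] i(3) by (auto simp: glue_i_def i'_def restrict_def)
  qed
  show "glue_f k q j f' = f"
  proof
    fix x
    have "f x = k" if "x \<in> {q<..q + j}"
      using that unfolding fib[symmetric] by simp
    then show "glue_f k q j f' x = f x"
      using qj PiE_arb[OF f(1), of x]
      by (cases "x \<in> {q<..q + j}") (auto simp: glue_f_def f'_def)
  qed
qed

text \<open>Cutting and gluing give a bijection between the index pairs and the data (j, e,
  remaining pair). Inadmissible (j, e) are kept with value 0, so that the ranges are rectangular and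
  sums can be exchanged later.\<close>

lemma sum_gap_set:
  fixes F :: "(nat \<Rightarrow> nat) \<Rightarrow> (nat \<Rightarrow> nat) \<Rightarrow> 'a :: comm_monoid_add"
  assumes "k < d" "1 \<le> p" "q \<le> m"
  shows "(\<Sum>(i, f)\<in>gap_set n m d k p q. F i f) =
    (\<Sum>j\<le>m - q. \<Sum>e\<le>1. if (j = 0 \<and> e = 0) \<or> n < p + e then 0 else
      (\<Sum>(i, f)\<in>gap_set n m d (Suc k) (p + e) (q + j). F (glue_i k p i) (glue_f k q j f)))"
proof -
  define S where "S = {(j, e). j \<le> m - q \<and> e \<le> (1::nat) \<and> (j \<noteq> 0 \<or> e \<noteq> 0) \<and> p + e \<le> n}"
  have fS: "finite S"
    by (rule finite_subset[of _ "{..m - q} \<times> {..1}"]) (auto simp: S_def)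
  have "(\<Sum>(i, f)\<in>gap_set n m d k p q. F i f) =
     (\<Sum>((j, e), (i, f))\<in>(SIGMA x:S. gap_set n m d (Suc k) (p + snd x) (q + fst x)).
        F (glue_i k p i) (glue_f k q j f))"
  proof (rule sum.reindex_bij_witness[where
      i = "\<lambda>((j, e), (i, f)). (glue_i k p i, glue_f k q j f)" and
      j = "\<lambda>(i, f). let j = card {x \<in> {q<..m}. f x = k}; e = i (Suc k) - p in
        ((j, e), (restrict i {Suc k..d}, restrict f {q + j<..m}))"], goal_cases)
    case (1 a)
    obtain i f where a: "a = (i, f)" by (cases a)
    show ?case
      using cut_in_gap_set(6,7)[OF assms(1) 1[unfolded a] assms(3)] by (simp add: a Let_def)
  next
    case (2 a)
    obtain i f where a: "a = (i, f)" by (cases a)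
    show ?case
    proof -
      define j e where "j = card {x \<in> {q<..m}. f x = k}" and "e = i (Suc k) - p"
      show ?thesis
        using cut_in_gap_set(1-5)[OF assms(1) 2[unfolded a] assms(3), folded j_def e_def]
        unfolding a prod.case Let_def j_def[symmetric] e_def[symmetric] by (auto simp: S_def)
    qed
  next
    case (3 b)
    obtain j e i f where b: "b = ((j, e), (i, f))" by (metis prod.exhaust)
    have h: "j \<le> m - q" "e \<le> 1" "j \<noteq> 0 \<or> e \<noteq> 0" "p + e \<le> n"
      "(i, f) \<in> gap_set n m d (Suc k) (p + e) (q + j)"
      using 3 by (auto simp: b S_def)
    then have fib: "{x \<in> {q<..m}. glue_f k q j f x = k} = {q<..q + j}"
      using assms by (intro glue_in_gap_set(2)[OF assms(1) h(5)]) auto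
    have ie: "i (Suc k) = p + e" and i: "i \<in> {Suc k..d} \<rightarrow>\<^sub>E {1..n}" and f: "f \<in> {q + j<..m} \<rightarrow>\<^sub>E {Suc k..<d}"
      using h(5) by (auto simp: gap_set_def)
    have "restrict (glue_i k p i) {Suc k..d} = i"
      using PiE_arb[OF i] by (auto simp: glue_i_def restrict_def fun_eq_iff)
    moreover have "restrict (glue_f k q j f) {q + j<..m} = f"
      using PiE_arb[OF f] by (auto simp: glue_f_def restrict_def fun_eq_iff)
    moreover have "glue_i k p i (Suc k) - p = e"
      using ie by (simp add: glue_i_def)
    ultimately show ?case
      unfolding b prod.case Let_def fib by simp
  next
    case (4 b)
    obtain j e i f where b: "b = ((j, e), (i, f))" by (metis prod.exhaust)
    show ?case
      using 4 assms by (auto simp: b S_def intro!: glue_in_gap_set(1))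
  next
    case (5 a)
    obtain i f where a: "a = (i, f)" by (cases a)
    show ?case
      using cut_in_gap_set(6,7)[OF assms(1) 5[unfolded a] assms(3)] by (simp add: a Let_def)
  qed
  also have "\<dots> = (\<Sum>(j, e)\<in>S. (\<Sum>(i, f)\<in>gap_set n m d (Suc k) (p + e) (q + j). F (glue_i k p i) (glue_f k q j f)))"
    by (subst sum.Sigma[symmetric]) (auto simp: fS finite_gap_set case_prod_unfold)
  also have "\<dots> = (\<Sum>(j, e)\<in>{..m - q} \<times> {..1}. if (j = 0 \<and> e = 0) \<or> n < p + e then 0 else
      (\<Sum>(i, f)\<in>gap_set n m d (Suc k) (p + e) (q + j). F (glue_i k p i) (glue_f k q j f)))"
  proof (rule sum.mono_neutral_cong_left)
    show "\<forall>x\<in>{..m - q} \<times> {..1} - S. (case x of (j, e) \<Rightarrow> if (j = 0 \<and> e = 0) \<or> n < p + e then 0 else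
      (\<Sum>(i, f)\<in>gap_set n m d (Suc k) (p + e) (q + j). F (glue_i k p i) (glue_f k q j f))) = 0"
    proof
      fix x assume "x \<in> {..m - q} \<times> {..1} - S"
      moreover obtain j e where x: "x = (j, e)" by (cases x)
      ultimately have "(j = 0 \<and> e = 0) \<or> n < p + e"
        by (auto simp: S_def)
      then show "(case x of (j, e) \<Rightarrow> if (j = 0 \<and> e = 0) \<or> n < p + e then 0 else
        (\<Sum>(i, f)\<in>gap_set n m d (Suc k) (p + e) (q + j). F (glue_i k p i) (glue_f k q j f))) = 0"
        unfolding x prod.case by (rule if_P)
    qed
  next
    fix x assume "x \<in> S"
    then show "(case x of (j, e) \<Rightarrow> \<Sum>(i, f)\<in>gap_set n m d (Suc k) (p + e) (q + j).
        F (glue_i k p i) (glue_f k q j f)) =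
      (case x of (j, e) \<Rightarrow> if (j = 0 \<and> e = 0) \<or> n < p + e then 0 else
      (\<Sum>(i, f)\<in>gap_set n m d (Suc k) (p + e) (q + j). F (glue_i k p i) (glue_f k q j f)))"
      by (auto simp: S_def)
  qed (auto simp: S_def)
  also have "\<dots> = (\<Sum>j\<le>m - q. \<Sum>e\<le>1. if (j = 0 \<and> e = 0) \<or> n < p + e then 0 else
      (\<Sum>(i, f)\<in>gap_set n m d (Suc k) (p + e) (q + j). F (glue_i k p i) (glue_f k q j f)))"
    by (rule sum.cartesian_product[symmetric])
  finally show ?thesis .
qed

text \<open>Without gaps f has empty codomain, so every b must already be consumed, and the single
  remaining index equals both p and n. The summand is 1 because the product over the gaps is
  empty.\<close>

lemma gap_set_last:
  assumes "1 \<le> p" "p \<le> n" "q \<le> m"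
  shows "(\<Sum>(i, f)\<in>gap_set n m d d p q. 1 :: 'a :: semiring_1) = (if p = n \<and> q = m then 1 else 0)"
proof (cases "p = n \<and> q = m")
  case True
  have "gap_set n m d d p q = {(\<lambda>x\<in>{d}. n, \<lambda>_. undefined)}"
    using True assms by (auto simp: gap_set_def PiE_def extensional_def mono_on_def)
  then show ?thesis using True by simp
next
  case False
  then have "gap_set n m d d p q = {}"
    using assms by (auto simp: gap_set_def PiE_def Pi_def)
  then show ?thesis using False by simp
qed

text \<open>The l-th factor of the product once the first q letters of \<open>bs\<close> are
  consumed: they no longer enter V, but their share of the exponent of \<iota> is kept through
  \<open>{0<..q}\<close>.\<close>

definition gap_factor ::
  "nat list \<Rightarrow> complex list \<Rightarrow> nat \<Rightarrow> (nat \<Rightarrow> nat) \<Rightarrow> (nat \<Rightarrow> nat) \<Rightarrow> nat \<Rightarrow> complex free_alg" where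
  "gap_factor bs as q i f l =
     (let J = {j \<in> {q<..length bs}. f j = l} in
       if J = {} then 1 else U (i (l + 1) + (\<Sum>j\<in>J. bs ! (j - 1)) - i l - 1)) *
     word [flip (\<Sum>j\<in>{0<..q} \<union> {j \<in> {q<..length bs}. f j \<le> l}. bs ! (j - 1) - 1) (as ! (i (l + 1) - 1))]"

definition gap_sum :: "nat list \<Rightarrow> complex list \<Rightarrow> nat \<Rightarrow> nat \<Rightarrow> nat \<Rightarrow> nat \<Rightarrow> complex free_alg" where
  "gap_sum bs as d k p q = (\<Sum>(i, f)\<in>gap_set (length as) (length bs) d k p q.
     prod_list (map (gap_factor bs as q i f) [k..<d]))"

text \<open>
  The sum over all sequences of \<open>l\<close> gaps; a gap consumes \<open>j\<close> letters of \<open>bs\<close> and \<open>e \<le> 1\<close>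
  letters of \<open>as\<close>, not both zero.  The head of \<open>as\<close> is the letter before the first gap, which
  is used again when \<open>e = 0\<close>.
\<close>

fun steps :: "nat \<Rightarrow> nat list \<Rightarrow> complex list \<Rightarrow> complex free_alg" where
  "steps 0 bs as = (if bs = [] \<and> length as = 1 then 1 else 0)"
| "steps (Suc l) bs as = (\<Sum>j\<le>length bs. \<Sum>e\<le>1. if (j = 0 \<and> e = 0) \<or> length as \<le> e then 0 else
     (if j = 0 then 1 else U (e + sum_list (take j bs) - 1)) *
     word [flip (sum_list (map (\<lambda>b. b - 1) (take j bs))) (as ! e)] *
     steps l (drop j bs) (map (flip (sum_list (map (\<lambda>b. b - 1) (take j bs)))) (drop e as)))"

lemma sum_segment:
  "q + j \<le> length bs \<Longrightarrow> (\<Sum>x\<in>{q<..q + j}. g (bs ! (x - 1))) = sum_list (map g (take j (drop q bs)))"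
proof (induction j)
  case (Suc j)
  have "{q<..q + Suc j} = insert (q + Suc j) {q<..q + j}"
    by auto
  then have "(\<Sum>x\<in>{q<..q + Suc j}. g (bs ! (x - 1))) = g (bs ! (q + j)) + (\<Sum>x\<in>{q<..q + j}. g (bs ! (x - 1)))"
    by simp
  then show ?case
    using Suc by (simp add: take_Suc_conv_app_nth add.commute)
qed simp

text \<open>Induction on the number l of remaining gaps. The exponents of the consumed prefix,
  common to all remaining factors, are moved onto the letters of \<open>as\<close>. The offset p - 1
  keeps a_p as the head.\<close>

lemma gap_sum_steps:
  assumes "1 \<le> p" "p \<le> length as" "q \<le> length bs"
  shows "gap_sum bs as (k + l) k p q =
    steps l (drop q bs) (map (flip (sum_list (map (\<lambda>b. b - 1) (take q bs)))) (drop (p - 1) as))"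
  using assms
proof (induction l arbitrary: k p q)
  case 0
  then show ?case
    using gap_set_last[OF 0, where 'a = "complex free_alg", of k] by (auto simp: gap_sum_def)
next
  case (Suc l)
  let ?d = "k + Suc l" and ?n = "length as" and ?m = "length bs"
  define sh where "sh = (\<lambda>q. sum_list (map (\<lambda>b. b - 1) (take q bs)))"
  have "gap_sum bs as ?d k p q = (\<Sum>j\<le>?m - q. \<Sum>e\<le>1. if (j = 0 \<and> e = 0) \<or> ?n < p + e then 0 else
      (\<Sum>(i, f)\<in>gap_set ?n ?m ?d (Suc k) (p + e) (q + j).
        prod_list (map (gap_factor bs as q (glue_i k p i) (glue_f k q j f)) [k..<?d])))"
    unfolding gap_sum_def by (rule sum_gap_set) (use Suc.prems in auto)
  also have "\<dots> = (\<Sum>j\<le>?m - q. \<Sum>e\<le>1. if (j = 0 \<and> e = 0) \<or> ?n < p + e then 0 else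
     (if j = 0 then 1 else U (e + sum_list (take j (drop q bs)) - 1)) *
     word [flip (sh (q + j)) (as ! (p + e - 1))] * gap_sum bs as ?d (Suc k) (p + e) (q + j))"
  proof (intro sum.cong refl if_cong)
    fix j e :: nat assume j: "j \<in> {..?m - q}" and e: "e \<in> {..1}" and je: "\<not> ((j = 0 \<and> e = 0) \<or> ?n < p + e)"
    have qj: "q + j \<le> ?m" using j Suc.prems by auto
    have "prod_list (map (gap_factor bs as q (glue_i k p i) (glue_f k q j f)) [k..<?d])
       = (if j = 0 then 1 else U (e + sum_list (take j (drop q bs)) - 1)) *
       word [flip (sh (q + j)) (as ! (p + e - 1))] *
       prod_list (map (gap_factor bs as (q + j) i f) [Suc k..<?d])"
      if if_in: "(i, f) \<in> gap_set ?n ?m ?d (Suc k) (p + e) (q + j)" for i f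
    proof -
      have fk: "Suc k \<le> f x" if "x \<in> {q + j<..?m}" for x
        using if_in that by (auto simp: gap_set_def dest: PiE_mem)
      have ik: "i (Suc k) = p + e"
        using if_in by (auto simp: gap_set_def)
      have fib: "{x \<in> {q<..?m}. glue_f k q j f x = k} = {q<..q + j}"
        using glue_in_gap_set(2)[OF _ if_in] e je qj Suc.prems by auto
      have low: "{0<..q} \<union> {x \<in> {q<..?m}. glue_f k q j f x \<le> k} = {0<..0 + (q + j)}"
      proof -
        have "glue_f k q j f x \<le> k \<longleftrightarrow> x \<in> {q<..q + j}" if "x \<in> {q<..?m}" for x
          using fk[of x] that by (auto simp: glue_f_def)
        then show ?thesis using qj by auto
      qed
      have "gap_factor bs as q (glue_i k p i) (glue_f k q j f) k =
         (if j = 0 then 1 else U (e + sum_list (take j (drop q bs)) - 1)) *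
         word [flip (sh (q + j)) (as ! (p + e - 1))]"
        unfolding gap_factor_def fib low Let_def
        using sum_segment[OF qj, of "\<lambda>b. b"] sum_segment[of 0 "q + j" bs "\<lambda>b. b - 1"] qj ik
        by (auto simp: glue_i_def sh_def)
      moreover have "gap_factor bs as q (glue_i k p i) (glue_f k q j f) l' = gap_factor bs as (q + j) i f l'"
        if "l' \<in> set [Suc k..<?d]" for l'
      proof -
        have "k < l'" using that by auto
        then have sets: "{x \<in> {q<..?m}. glue_f k q j f x = l'} = {x \<in> {q + j<..?m}. f x = l'}"
          "{0<..q} \<union> {x \<in> {q<..?m}. glue_f k q j f x \<le> l'} = {0<..q + j} \<union> {x \<in> {q + j<..?m}. f x \<le> l'}"
          using qj by (auto simp: glue_f_def)
        have gi: "glue_i k p i l' = i l'" "glue_i k p i (l' + 1) = i (l' + 1)"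
          using \<open>k < l'\<close> by (auto simp: glue_i_def)
        show ?thesis
          unfolding gap_factor_def sets gi by (rule refl)
      qed
      then have "map (gap_factor bs as q (glue_i k p i) (glue_f k q j f)) [Suc k..<?d]
         = map (gap_factor bs as (q + j) i f) [Suc k..<?d]"
        by (rule map_cong[OF refl])
      moreover have "[k..<?d] = k # [Suc k..<?d]"
        by (simp add: upt_conv_Cons)
      ultimately show ?thesis
        by (simp only: list.map prod_list.Cons)
    qed
    then show "(\<Sum>(i, f)\<in>gap_set ?n ?m ?d (Suc k) (p + e) (q + j).
        prod_list (map (gap_factor bs as q (glue_i k p i) (glue_f k q j f)) [k..<?d]))
      = (if j = 0 then 1 else U (e + sum_list (take j (drop q bs)) - 1)) *
       word [flip (sh (q + j)) (as ! (p + e - 1))] * gap_sum bs as ?d (Suc k) (p + e) (q + j)"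
      unfolding gap_sum_def sum_distrib_left by (intro sum.cong) auto
  qed
  also have "\<dots> = steps (Suc l) (drop q bs) (map (flip (sh q)) (drop (p - 1) as))"
    unfolding steps.simps
  proof (intro sum.cong if_cong)
    fix j e :: nat assume j: "j \<in> {..length (drop q bs)}" and e: "e \<in> {..1}"
      and je: "\<not> ((j = 0 \<and> e = 0) \<or> length (map (flip (sh q)) (drop (p - 1) as)) \<le> e)"
    have pe: "p + e \<le> ?n" "p - 1 + e < ?n" using je Suc.prems by auto
    have qj: "q + j \<le> ?m" using j Suc.prems by auto
    have s: "sh (q + j) = sum_list (map (\<lambda>b. b - 1) (take j (drop q bs))) + sh q"
      "sh (j + q) = sum_list (map (\<lambda>b. b - 1) (take j (drop q bs))) + sh q"
      by (simp_all add: sh_def take_add add.commute[of j])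
    have "gap_sum bs as ?d (Suc k) (p + e) (q + j) =
       steps l (drop (q + j) bs) (map (flip (sh (q + j))) (drop (p + e - 1) as))"
      using Suc.IH[of "p + e" "q + j" "Suc k"] Suc.prems pe qj by (simp add: sh_def)
    moreover have "as ! (p + e - 1) = drop (p - 1) as ! e" "p + e - 1 = e + (p - 1)"
      using pe Suc.prems by (auto simp: add.commute)
    ultimately show "(if j = 0 then 1 else U (e + sum_list (take j (drop q bs)) - 1)) *
       word [flip (sh (q + j)) (as ! (p + e - 1))] * gap_sum bs as ?d (Suc k) (p + e) (q + j)
       = (if j = 0 then 1 else U (e + sum_list (take j (drop q bs)) - 1)) *
       word [flip (sum_list (map (\<lambda>b. b - 1) (take j (drop q bs)))) (map (flip (sh q)) (drop (p - 1) as) ! e)] *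
       steps l (drop j (drop q bs)) (map (flip (sum_list (map (\<lambda>b. b - 1) (take j (drop q bs))))) (drop e (map (flip (sh q)) (drop (p - 1) as))))"
      using pe by (simp add: s flip_flip drop_map add.commute o_def)
  qed (use Suc.prems in auto)
  finally show ?case by (simp add: sh_def)
qed

text \<open>Each gap consumes at least one letter in total and at most one of \<open>as\<close>; at
  the end a single letter of \<open>as\<close> and none of \<open>bs\<close> must remain.\<close>

lemma steps_eq_0:
  "l + 1 < length as \<or> length as + length bs < l + 1 \<Longrightarrow> steps l bs as = 0"
proof (induction l arbitrary: bs as)
  case (Suc l)
  have "steps l (drop j bs) (map (flip s) (drop e as)) = 0"
    if "j \<le> length bs" "e \<le> 1" "\<not> ((j = 0 \<and> e = 0) \<or> length as \<le> e)" for j e s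
    by (rule Suc.IH) (use that Suc.prems in auto)
  then show ?case
    unfolding steps.simps by (intro sum.neutral ballI) (auto split: if_splits)
qed auto

text \<open>The exponent agrees modulo 2 with the number of letters minus \<open>l + 1\<close>, avoiding truncation.\<close>

definition signed_steps :: "nat list \<Rightarrow> complex list \<Rightarrow> complex free_alg" where
  "signed_steps bs as = (\<Sum>l<length bs + length as. (- 1) ^ (length bs + length as + 1 + l) * steps l bs as)"

section \<open>The action as a signed sum over gap sequences\<close>

lemma iota_funpow_word: "(iota ^^ k) (word w) = word (map (flip k) w)"
proof (induction k)
  case (Suc k)
  have "flip (Suc k) = (\<lambda>z. 1 - z) \<circ> flip k"
    by (simp add: fun_eq_iff flip_Suc)
  then show ?case
    using Suc by (simp add: iota_def lin_ext_word o_def)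
qed simp

text \<open>The first letter a_1 stands outside the product and d indices leave d - 1 gaps, so the
  sum is reindexed by l = d - 1; the range of l may be extended because \<open>steps\<close>
  vanishes on the added values.\<close>

lemma triangle_word_steps:
  assumes "as \<noteq> []"
  shows "triangle_word bs as = word [hd as] * signed_steps bs as"
proof -
  let ?n = "length as" and ?m = "length bs"
  have n: "1 \<le> ?n" using assms by (cases as) auto
  have inner: "(\<Sum>(i, f)\<in>index_set ?n ?m d. word [as ! (i 1 - 1)] *
       prod_list (map (\<lambda>k. V_factor bs i f k *
         (iota ^^ s_exp bs f k) (word [as ! (i (k + 1) - 1)])) [1..<d]))
    = word [hd as] * steps (d - 1) bs as" if d: "1 \<le> d" for d
  proof -
    have e: "{Suc 0..m} = {0<..m}" for m
      by auto
    have "V_factor bs i f k * (iota ^^ s_exp bs f k) (word [as ! (i (k + 1) - 1)]) = gap_factor bs as 0 i f k" for i f k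
      by (simp add: gap_factor_def V_factor_def s_exp_def iota_funpow_word e)
    moreover have "as ! (i 1 - 1) = hd as" if "(i, f) \<in> gap_set ?n ?m d 1 1 0" for i f
      using that assms by (auto simp: gap_set_def hd_conv_nth)
    ultimately have "(\<Sum>(i, f)\<in>index_set ?n ?m d. word [as ! (i 1 - 1)] *
       prod_list (map (\<lambda>k. V_factor bs i f k *
         (iota ^^ s_exp bs f k) (word [as ! (i (k + 1) - 1)])) [1..<d]))
      = word [hd as] * gap_sum bs as d 1 1 0"
      unfolding gap_sum_def index_set_conv_gap_set sum_distrib_left
      by (intro sum.cong) auto
    also have "gap_sum bs as d 1 1 0 = steps (d - 1) bs as"
      using gap_sum_steps[of 1 as 0 bs 1 "d - 1"] n d by simp
    finally show ?thesis .
  qed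
  have c: "(- 1) ^ k * (word w * p) = word w * ((- 1) ^ k * p)" for k w and p :: "complex free_alg"
    by (cases "even k") auto
  have "triangle_word bs as = (\<Sum>d = ?n..?n + ?m. (- 1) ^ (?n + ?m - d) * (word [hd as] * steps (d - 1) bs as))"
    unfolding triangle_word_def Let_def
    by (intro sum.cong refl arg_cong2[where f = "(*)"] inner) (use n in auto)
  also have "\<dots> = word [hd as] * (\<Sum>d = ?n..?n + ?m. (- 1) ^ (?n + ?m - d) * steps (d - 1) bs as)"
    by (simp only: c sum_distrib_left)
  also have "(\<Sum>d = ?n..?n + ?m. (- 1) ^ (?n + ?m - d) * steps (d - 1) bs as)
     = (\<Sum>l = ?n - 1..?n + ?m - 1. (- 1) ^ (?n + ?m - Suc l) * steps l bs as)"
    by (rule sum.reindex_bij_witness[of _ Suc "\<lambda>d. d - 1"]) (use n in auto)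
  also have "\<dots> = (\<Sum>l<?m + ?n. (- 1) ^ (?m + ?n + 1 + l) * steps l bs as)"
  proof (rule sum.mono_neutral_cong_left)
    show "\<forall>l\<in>{..<?m + ?n} - {?n - 1..?n + ?m - 1}. (- 1) ^ (?m + ?n + 1 + l) * steps l bs as = 0"
    proof
      fix l assume "l \<in> {..<?m + ?n} - {?n - 1..?n + ?m - 1}"
      then have "steps l bs as = 0"
        by (intro steps_eq_0) auto
      then show "(- 1) ^ (?m + ?n + 1 + l) * steps l bs as = 0" by simp
    qed
  next
    fix l assume l: "l \<in> {?n - 1..?n + ?m - 1}"
    have "even (?n + ?m - Suc l) = even (?m + ?n + 1 + l)"
      using l n by auto
    then show "(- 1) ^ (?n + ?m - Suc l) * steps l bs as = (- 1) ^ (?m + ?n + 1 + l) * steps l bs as"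
      by (simp add: minus_one_power_iff)
  qed (use n in auto)
  finally show ?thesis
    by (simp add: signed_steps_def)
qed

text \<open>What remains after the first gap, together with the letter closing that gap, is again a
  \<open>triangle_word\<close>. Dropping j + e letters and one gap gives the sign.\<close>

lemma signed_steps_rec:
  "signed_steps bs as = (if bs = [] \<and> length as = 1 then 1 else 0) +
    (\<Sum>j\<le>length bs. \<Sum>e\<le>1. if (j = 0 \<and> e = 0) \<or> length as \<le> e then 0 else
     (- 1) ^ (j + e + 1) * ((if j = 0 then 1 else U (e + sum_list (take j bs) - 1)) *
     triangle_word (drop j bs) (map (flip (sum_list (map (\<lambda>b. b - 1) (take j bs)))) (drop e as))))"
  (is "_ = ?base + ?R")
proof -
  let ?N = "length bs + length as"
  \<comment> \<open>The remainders have different lengths; padding all signed sums with vanishing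
    terms to a common N allows the order of summation to be exchanged.\<close>
  have ext: "signed_steps bs as = (\<Sum>l<N. (- 1) ^ (length bs + length as + 1 + l) * steps l bs as)"
    if "length bs + length as \<le> N" for N bs as
    unfolding signed_steps_def
  proof (rule sum.mono_neutral_left)
    show "\<forall>l\<in>{..<N} - {..<length bs + length as}. (- 1) ^ (length bs + length as + 1 + l) * steps l bs as = 0"
    proof
      fix l assume "l \<in> {..<N} - {..<length bs + length as}"
      then have "steps l bs as = 0"
        by (intro steps_eq_0) auto
      then show "(- 1) ^ (length bs + length as + 1 + l) * steps l bs as = 0" by simp
    qed
  qed (use that in auto)
  have c: "(- 1) ^ a * (- 1) ^ b * (p * q * r) = (- 1) ^ a * (p * (q * ((- 1) ^ b * r)))"
    for a b and p q r :: "complex free_alg"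
    by (cases "even b") (simp_all add: mult.assoc)
  have sw: "(\<Sum>l<N. \<Sum>j\<le>J. \<Sum>e\<le>E. F l j e) = (\<Sum>j\<le>J. \<Sum>e\<le>E. \<Sum>l<N. F l j e)"
    for N J E :: nat and F :: "nat \<Rightarrow> nat \<Rightarrow> nat \<Rightarrow> complex free_alg"
    by (rule trans[OF sum.swap sum.cong[OF refl sum.swap]])
  have "signed_steps bs as = (\<Sum>l<Suc ?N. (- 1) ^ (?N + 1 + l) * steps l bs as)"
    by (rule ext) simp
  also have "\<dots> = (- 1) ^ (?N + 1) * steps 0 bs as + (\<Sum>l<?N. (- 1) ^ (?N + l) * steps (Suc l) bs as)"
    unfolding sum.lessThan_Suc_shift by simp
  also have "(- 1) ^ (?N + 1) * steps 0 bs as = ?base"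
    by auto
  also have "(\<Sum>l<?N. (- 1) ^ (?N + l) * steps (Suc l) bs as) =
    (\<Sum>j\<le>length bs. \<Sum>e\<le>1. \<Sum>l<?N. (- 1) ^ (?N + l) * (if (j = 0 \<and> e = 0) \<or> length as \<le> e then 0 else
     (if j = 0 then 1 else U (e + sum_list (take j bs) - 1)) *
     word [flip (sum_list (map (\<lambda>b. b - 1) (take j bs))) (as ! e)] *
     steps l (drop j bs) (map (flip (sum_list (map (\<lambda>b. b - 1) (take j bs)))) (drop e as))))"
    unfolding steps.simps sum_distrib_left
    by (rule sw)
  also have "\<dots> = ?R"
  proof (intro sum.cong refl)
    fix j e :: nat assume je: "j \<in> {..length bs}" "e \<in> {..1}"
    define s where "s = sum_list (map (\<lambda>b. b - 1) (take j bs))"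
    define V where "V = (if j = 0 then 1 else U (e + sum_list (take j bs) - 1))"
    show "(\<Sum>l<?N. (- 1) ^ (?N + l) * (if (j = 0 \<and> e = 0) \<or> length as \<le> e then 0 else
       V * word [flip s (as ! e)] * steps l (drop j bs) (map (flip s) (drop e as))))
       = (if (j = 0 \<and> e = 0) \<or> length as \<le> e then 0 else
     (- 1) ^ (j + e + 1) * (V * triangle_word (drop j bs) (map (flip s) (drop e as))))"
    proof (cases "(j = 0 \<and> e = 0) \<or> length as \<le> e")
      case False
      let ?bs = "drop j bs" and ?as = "map (flip s) (drop e as)"
      have sg: "(- 1) ^ (?N + l) = (- 1) ^ (j + e + 1) * (- 1 :: complex free_alg) ^ (length ?bs + length ?as + 1 + l)" for l
      proof -
        have "(j + e + 1) + (length ?bs + length ?as + 1 + l) = ?N + l + 2"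
          using je False by auto
        then show ?thesis
          by (simp only: flip: power_add) simp
      qed
      have "triangle_word ?bs ?as = word [flip s (as ! e)] * signed_steps ?bs ?as"
        using triangle_word_steps[of ?as ?bs] False by (simp add: hd_map hd_drop_conv_nth)
      also have "signed_steps ?bs ?as = (\<Sum>l<?N. (- 1) ^ (length ?bs + length ?as + 1 + l) * steps l ?bs ?as)"
        by (rule ext) auto
      finally show ?thesis
        using False by (simp only: if_False sg c sum_distrib_left)
    qed simp
  qed
  finally show ?thesis .
qed

subsection \<open>A recursion for the action\<close>

text \<open>The value \<open>0\<close> on the empty word drops the terms in which the second argument is exhausted.\<close>

definition tri :: "nat list \<Rightarrow> complex list \<Rightarrow> complex free_alg" where
  "tri bs as = (if as = [] then 0 else triangle_word bs as)"

text \<open>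
  For \<open>K = b\<close> this is, up to \<open>\<iota>\<close>, the contribution to \<open>x\<^sub>b u \<triangleright> e\<^sub>c w\<close> of the index pairs whose
  first gap is hit by \<open>f\<close>.  A general \<open>K\<close> is needed to evaluate the sum by induction on \<open>bs\<close>.
\<close>

definition tri_tail :: "nat \<Rightarrow> nat list \<Rightarrow> complex \<Rightarrow> complex list \<Rightarrow> complex free_alg" where
  "tri_tail K bs c w = (\<Sum>j\<le>length bs.
     let S = sum_list (take j bs); s = sum_list (map (\<lambda>b. b - 1) (take j bs)) in
     (- 1) ^ j * (U (K + S - 1) * tri (drop j bs) (map (flip s) (c # w))
       - U (K + S) * tri (drop j bs) (map (flip s) w)))"

lemma tri_tail_Nil: "tri_tail K [] c w = U (K - 1) * tri [] (c # w) - U K * tri [] w"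
  by (simp add: tri_tail_def del: map_map)

text \<open>The term j = 0 is split off; in the others the prefix starts with b, which raises K by
  b, flips both words b - 1 times and reverses the sign.\<close>

lemma tri_tail_Cons:
  "tri_tail K (b # bs) c w =
     U (K - 1) * tri (b # bs) (c # w) - U K * tri (b # bs) w
     - tri_tail (K + b) bs (flip (b - 1) c) (map (flip (b - 1)) w)"
proof -
  have "tri_tail K (b # bs) c w =
     U (K - 1) * tri (b # bs) (c # w) - U K * tri (b # bs) w
     + (\<Sum>j\<le>length bs. - (let S = sum_list (take j bs);
         s = sum_list (map (\<lambda>b. b - 1) (take j bs)) in
     (- 1) ^ j * (U (K + b + S - 1) * tri (drop j bs) (map (flip s) (flip (b - 1) c # map (flip (b - 1)) w))
       - U (K + b + S) * tri (drop j bs) (map (flip s) (map (flip (b - 1)) w)))))"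
    unfolding tri_tail_def list.size sum.atMost_Suc_shift add_Suc_right add_0_right
    by (intro arg_cong2[where f = "(+)"] sum.cong)
      (simp_all add: Let_def map_flip_flip flip_flip add_ac algebra_simps del: map_map)
  then show ?thesis
    by (simp only: tri_tail_def sum_negf diff_conv_add_uminus)
qed

text \<open>The unit law: with no letters to place, every gap must advance with weight 1, so only j
  = 0, e = 1 contributes.\<close>

lemma tri_Nil: "as \<noteq> [] \<Longrightarrow> tri [] as = word as"
proof (induction as)
  case (Cons c w)
  have "tri [] (c # w) = word [c] * signed_steps [] (c # w)"
    by (simp add: tri_def triangle_word_steps)
  also have "signed_steps [] (c # w) = word w"
  proof (cases "w = []")
    case True
    then show ?thesis
      by (subst signed_steps_rec) (simp add: atMost_Suc word_Nil)
  next
    case False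
    then show ?thesis
      using Cons.IH by (subst signed_steps_rec) (simp add: atMost_Suc tri_def)
  qed
  finally show ?case
    by (simp add: word_mult)
qed simp

text \<open>The unhit first gap (j = 0, e = 1) gives the first summand. In all other terms the
  prefix contains b, and the cases e = 0 and e = 1 give the two parts of
  \<open>tri_tail\<close>.\<close>

lemma tri_Cons:
  "tri (b # bs) (c # w) = word [c] * (tri (b # bs) w
     + tri_tail b bs (flip (b - 1) c) (map (flip (b - 1)) w))"
proof -
  have "tri (b # bs) (c # w) = word [c] * signed_steps (b # bs) (c # w)"
    by (simp add: tri_def triangle_word_steps)
  \<comment> \<open>The condition \<open>length as \<le> e\<close> disappears because
    \<open>tri\<close> vanishes on the exhausted word.\<close>
  also have "signed_steps (b # bs) (c # w) = (\<Sum>j\<le>Suc (length bs). \<Sum>e\<le>1. if (j = 0 \<and> e = 0) then 0 else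
     (- 1) ^ (j + e + 1) * ((if j = 0 then 1 else U (e + sum_list (take j (b # bs)) - 1)) *
     tri (drop j (b # bs)) (map (flip (sum_list (map (\<lambda>b. b - 1) (take j (b # bs))))) (drop e (c # w)))))"
    by (subst signed_steps_rec) (auto intro!: sum.cong simp: tri_def)
  also have "\<dots> = tri (b # bs) w + (\<Sum>j\<le>length bs. \<Sum>e\<le>1.
     (- 1) ^ (j + e) * (U (e + b + sum_list (take j bs) - 1) *
     tri (drop j bs) (map (flip (b - 1 + sum_list (map (\<lambda>b. b - 1) (take j bs)))) (drop e (c # w)))))"
    unfolding sum.atMost_Suc_shift by (simp add: atMost_Suc add_ac)
  also have "(\<Sum>j\<le>length bs. \<Sum>e\<le>1.
     (- 1) ^ (j + e) * (U (e + b + sum_list (take j bs) - 1) *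
     tri (drop j bs) (map (flip (b - 1 + sum_list (map (\<lambda>b. b - 1) (take j bs)))) (drop e (c # w)))))
    = tri_tail b bs (flip (b - 1) c) (map (flip (b - 1)) w)"
    unfolding tri_tail_def Let_def
    by (intro sum.cong refl) (simp add: atMost_Suc flip_flip o_def algebra_simps)
  finally show ?thesis .
qed

text \<open>
  After a last letter \<open>c\<close>, the missing value \<open>u \<triangleright> 1\<close> has to be read as the block word of \<open>u\<close>
  starting with \<open>c\<close>; in \<open>tri_ext0\<close> the value \<open>0\<close> corresponds to \<open>s\<^sub>k(1) = 0\<close>.
\<close>

definition tri_ext :: "complex \<Rightarrow> nat list \<Rightarrow> complex list \<Rightarrow> complex free_alg" where
  "tri_ext c bs w = (if w = [] then word (blocks c bs) else tri bs w)"

definition tri_ext0 :: "complex \<Rightarrow> nat list \<Rightarrow> complex list \<Rightarrow> complex free_alg" where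
  "tri_ext0 c bs w = (if w = [] \<and> bs = [] then 0 else tri_ext c bs w)"

text \<open>Of the two words in \<open>U (K - 1)\<close> this is the one that the next letter c
  continues alternatingly.\<close>

lemma alt_pre: "K \<ge> 1 \<Longrightarrow> word (alt (flip (K - 1) c) (K - 1)) * word [c] = word (alt (flip (K - 1) c) K)"
  by (cases K) (auto simp: word_mult alt_Suc_right flip_flip flip_def simp del: alt.simps(2))

text \<open>The telescoping. In \<open>U (K - 1)\<close> the word continued by c merges with the
  leading letter of \<open>tri bs (c # w)\<close>, and the resulting terms cancel against
  \<open>U K\<close> and the shorter tail; the other word survives. For empty w, block words
  compensate the value 0 of \<open>tri\<close>.\<close>

lemma tri_tail_eq:
  assumes "K \<ge> 1" "c \<in> {0, 1}" "\<forall>b\<in>set bs. 1 \<le> b"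
  shows "tri_tail K bs c w =
    word (alt (flip K c) (K - 1)) * tri bs (c # w)
    - word (alt (flip K c) K) * tri_ext0 c bs w
    + (if w = [] then word (alt (flip (K - 1) c) K) * word (blocks c bs) else 0)"
  using assms
proof (induction bs arbitrary: K c w)
  case Nil
  have U: "U n = word (alt (flip (K - 1) c) n) + word (alt (flip K c) n)" for n
    using U_alt_flip[OF Nil(2), of n "K - 1"] Nil(1) by simp
  have "word (alt (flip (K - 1) c) (K - 1)) * (word [c] * word w) = word (alt (flip (K - 1) c) K) * word w"
    using alt_pre[OF Nil(1), of c] by (simp flip: mult.assoc)
  then show ?case
    unfolding tri_tail_Nil U tri_ext0_def tri_ext_def
    using word_mult[of "[c]" w]
    by (auto simp: tri_Nil algebra_simps word_Nil tri_def[of _ "[]"])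
next
  case (Cons b bs)
  have b: "b \<ge> 1" and bs: "\<forall>b\<in>set bs. 1 \<le> b"
    using Cons.prems by auto
  have U: "U n = word (alt (flip (K - 1) c) n) + word (alt (flip K c) n)" for n
    using U_alt_flip[OF Cons.prems(2), of n "K - 1"] Cons.prems(1) by simp
  define c' w' where "c' = flip (b - 1) c" and "w' = map (flip (b - 1)) w"
  have c': "c' \<in> {0, 1}"
    using flip_in[OF Cons.prems(2)] by (simp add: c'_def)
  define X where "X = tri bs (c' # w')"
  define Y where "Y = tri_ext0 c' bs w'"
  define Z where "Z = (if w = [] then word (blocks c' bs) else 0)"
  define p where "p = flip (K - 1) c"
  have f1: "flip K c = 1 - p" "flip b c' = 1 - c" "flip (b - 1) c' = c" "flip (K + b) c' = p"
    "flip (K + b - 1) c' = 1 - p" "flip K p = 1 - c" "flip (K - 1) p = c" "flip K (1 - p) = c"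
    "flip (b - Suc 0) c' = c" "flip (K + b - Suc 0) c' = 1 - p" "flip (K - Suc 0) p = c"
    using Cons.prems(1,2) b by (auto simp: p_def c'_def flip_def)
  have w': "(w' = []) = (w = [])"
    by (simp add: w'_def)
  \<comment> \<open>The induction hypothesis serves twice: with K = b for the tail produced by
    \<open>tri_Cons\<close>, and with K + b for the one in \<open>tri_tail_Cons\<close>.\<close>
  have ih1: "tri_tail b bs c' w' =
     word (alt (1 - c) (b - 1)) * X - word (alt (1 - c) b) * Y + word (alt c b) * Z"
    using Cons.IH[OF b c' bs, of w'] by (simp add: f1 X_def Y_def Z_def w')
  have ih2: "tri_tail (K + b) bs c' w' =
     word (alt p (K + b - 1)) * X - word (alt p (K + b)) * Y + word (alt (1 - p) (K + b)) * Z"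
    using Cons.IH[of "K + b" c' w'] b c' bs Cons.prems(1) by (simp add: f1 X_def Y_def Z_def w')
  have tr: "tri (b # bs) (c # w) = word [c] * (tri (b # bs) w + tri_tail b bs c' w')"
    by (simp add: tri_Cons c'_def w'_def)
  have a1: "word (alt p K) * (word (alt (1 - c) (b - 1)) * X) = word (alt p (K + b - 1)) * X"
    unfolding Nat.add_diff_assoc[OF b, symmetric] by (simp only: word_mult_assoc alt_add f1)
  have a2: "word (alt p K) * (word (alt (1 - c) b) * Y) = word (alt p (K + b)) * Y"
    using alt_add[of p K b] by (simp add: word_mult_assoc f1)
  have a3: "word (alt (1 - p) (K + b)) * Z = word (alt (1 - p) K) * (word (alt c b) * Z)"
    using alt_add[of "1 - p" K b] by (simp add: word_mult_assoc f1)
  have "word (alt p (K - 1)) * tri (b # bs) (c # w)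
      = word (alt p K) * (tri (b # bs) w + tri_tail b bs c' w')"
    unfolding tr using alt_pre[OF Cons.prems(1), of c] by (simp add: p_def flip: mult.assoc)
  also have "\<dots> = word (alt p K) * tri (b # bs) w + word (alt p (K + b - 1)) * X
      - word (alt p (K + b)) * Y + word (alt p K) * (word (alt c b) * Z)"
    unfolding ih1 by (simp only: distrib_left right_diff_distrib a1 a2) (simp only: add_diff_eq add.assoc[symmetric])
  finally have main: "word (alt p (K - 1)) * tri (b # bs) (c # w)
     = word (alt p K) * tri (b # bs) w + word (alt p (K + b - 1)) * X
      - word (alt p (K + b)) * Y + word (alt p K) * (word (alt c b) * Z)" .
  have z: "word (alt c b) * Z = (if w = [] then word (blocks c (b # bs)) else 0)"
    by (simp add: Z_def word_mult c'_def)
  \<comment> \<open>For empty w the summand with Z is the block word that replaces the value 0 of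
    \<open>tri\<close>; otherwise Z is 0.\<close>
  have t0: "tri_ext0 c (b # bs) w = tri (b # bs) w + word (alt c b) * Z"
    unfolding z by (auto simp: tri_ext0_def tri_ext_def tri_def[of _ "[]"])
  have z2: "(if w = [] then word (alt p K) * word (blocks c (b # bs)) else 0)
    = word (alt p K) * (word (alt c b) * Z)"
    unfolding z by simp
  have "tri_tail K (b # bs) c w = U (K - 1) * tri (b # bs) (c # w) - U K * tri (b # bs) w
     - tri_tail (K + b) bs c' w'"
    by (simp add: tri_tail_Cons c'_def w'_def)
  also have "\<dots> = word (alt (1 - p) (K - 1)) * tri (b # bs) (c # w)
    - word (alt (1 - p) K) * tri_ext0 c (b # bs) w
    + word (alt p K) * (word (alt c b) * Z)"
    unfolding U f1 p_def[symmetric] distrib_right main ih2 t0 a3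
    by (simp add: algebra_simps)
  finally show ?case
    unfolding f1 p_def[symmetric] z2 .
qed

text \<open>\<open>tri_tail_eq\<close> with K = a is inserted into \<open>tri_Cons\<close>: the
  leading e_c completes each alternating prefix, and the boundary term for empty w turns
  \<open>tri\<close> into \<open>tri_ext\<close>.\<close>

lemma tri_Cons_letter:
  assumes "a \<ge> 1" "\<forall>b\<in>set u. 1 \<le> b" "c \<in> {0, 1}"
  shows "tri (a # u) (c # w) = word [c] * tri_ext c (a # u) w
    + word (alt c a) * tri u (map (flip (a - 1)) (c # w))
    - word (alt c (a + 1)) * tri_ext0 (flip (a - 1) c) u (map (flip (a - 1)) w)"
proof -
  define c' w' where "c' = flip (a - 1) c" and "w' = map (flip (a - 1)) w"
  have c': "c' \<in> {0, 1}"
    using flip_in[OF assms(3)] by (simp add: c'_def)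
  have f: "flip a c' = 1 - c" "flip (a - 1) c' = c"
    using assms(1,3) by (auto simp: c'_def flip_def)
  have al: "alt c a = c # alt (1 - c) (a - 1)"
    using assms(1) by (cases a) auto
  have e: "word [c] * tri (a # u) w + word [c] * (if w = [] then word (alt c a) * word (blocks c' u) else 0)
     = word [c] * tri_ext c (a # u) w"
    by (simp add: tri_ext_def c'_def word_mult tri_def)
  show ?thesis
    unfolding tri_Cons
    unfolding c'_def[symmetric] w'_def[symmetric] tri_tail_eq[OF assms(1) c' assms(2)] f list.map
    unfolding al distrib_left right_diff_distrib word_mult_assoc e[symmetric]
    by (simp add: w'_def al word_mult_assoc algebra_simps)
qed

text \<open>By induction along the alternating word: the correction terms telescope.\<close>

lemma tri_alt:
  assumes "a \<ge> 1" "\<forall>b\<in>set u. 1 \<le> b" "c \<in> {0, 1}" "b \<ge> 1"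
  shows "tri (a # u) (alt c b @ w) =
    word (alt c a) * tri u (map (flip (a - 1)) (alt c b @ w))
    + word (alt c b) * tri_ext (flip (b - 1) c) (a # u) w
    - word (alt c (a + b)) * tri_ext0 (flip (a + b - 2) c) u (map (flip (a - 1)) w)"
  using assms(4,3)
proof (induction b arbitrary: c rule: nat_induct_at_least)
  case base
  then show ?case
    using tri_Cons_letter[OF assms(1,2) base, of w] by (simp add: numeral_2_eq_2)
next
  case (Suc b)
  have c: "1 - c \<in> {0, 1}"
    using Suc.prems by auto
  have f: "flip (b - 1) (1 - c) = flip b c" "flip (a + b - 2) (1 - c) = flip (a + Suc b - 2) c"
    using Suc.hyps assms(1) by (auto simp: flip_def)
  obtain k where k: "b = Suc k"
    using Suc.hyps by (cases b) auto
  have n: "alt (1 - c) b @ w \<noteq> []" "map (flip (a - 1)) (alt (1 - c) b @ w) \<noteq> []"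
    by (simp_all add: k)
  \<comment> \<open>As b \<ge> 1, the rest is nonempty and both extensions reduce to
    \<open>tri\<close>. The last term of the letter recursion then cancels the first term of the
    induction hypothesis.\<close>
  have e: "tri_ext c (a # u) (alt (1 - c) b @ w) = tri (a # u) (alt (1 - c) b @ w)"
    "tri_ext0 (flip (a - 1) c) u (map (flip (a - 1)) (alt (1 - c) b @ w))
      = tri u (map (flip (a - 1)) (alt (1 - c) b @ w))"
    unfolding tri_ext0_def tri_ext_def using n by (simp_all only: if_False simp_thms)
  show ?case
    unfolding alt.simps(2) append_Cons tri_Cons_letter[OF assms(1,2) Suc.prems] e Suc.IH[OF c] f
    by (simp add: distrib_left right_diff_distrib word_mult_assoc del: map_append)
qed

subsection \<open>Comparison with the block shuffle product\<close>

text \<open>The map B with a variable first letter, needed because each block repeats the last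
  letter of the preceding one.\<close>

definition blocks_lin :: "complex \<Rightarrow> nat free_alg \<Rightarrow> complex free_alg" where
  "blocks_lin c = lin_ext (\<lambda>bs. word (blocks c bs))"

lemma blocks_lin_add: "blocks_lin c (p + q) = blocks_lin c p + blocks_lin c q"
  by (simp add: blocks_lin_def lin_ext_add)

lemma blocks_lin_diff: "blocks_lin c (p - q) = blocks_lin c p - blocks_lin c q"
  by (simp add: blocks_lin_def lin_ext_diff)

lemma blocks_lin_letter:
  "blocks_lin c (word [a] * p) = word (alt c a) * blocks_lin (flip (a - 1) c) p"
proof -
  have "word [a] * p = lin_ext (\<lambda>w. word (a # w)) p"
    by (subst (1) lin_ext_of_word[of p, symmetric]) (simp add: word_mult_lin_ext word_mult)
  then show ?thesis
    by (simp add: blocks_lin_def lin_ext_lin_ext lin_ext_word word_mult_lin_ext word_mult)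
qed

text \<open>Lengthening the first block by k prepends k alternating letters. The empty word is
  excluded because its shift is 0.\<close>

lemma blocks_lin_shift:
  assumes "p \<in> \<XX>_plus"
  shows "blocks_lin c (shift k p) = word (alt c k) * blocks_lin (flip k c) p"
  unfolding blocks_lin_def shift_def lin_ext_lin_ext word_mult_lin_ext
proof (rule lin_ext_cong)
  fix w assume w: "w \<in> Poly_Mapping.keys p"
  then obtain i v where v: "w = i # v"
    using assms by (cases w) (auto simp: \<XX>_plus_def)
  then have "i \<ge> 1"
    using w assms by (auto simp: \<XX>_plus_def \<XX>_def)
  then have "flip (i + k - 1) c = flip (i - 1) (flip k c)"
    by (simp add: flip_flip)
  then show "lin_ext (\<lambda>bs. word (blocks c bs)) (shift_word k w) = word (alt c k) * word (blocks (flip k c) w)"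
    using alt_add[of c k i] by (simp add: v lin_ext_word word_mult add.commute)
qed

section \<open>Nonempty words with positive entries under the block shuffle\<close>

lemma \<XX>_plus_iff:
  "p \<in> \<XX>_plus \<longleftrightarrow> Poly_Mapping.keys p \<subseteq> {w. w \<noteq> [] \<and> (\<forall>b\<in>set w. 1 \<le> b)}"
  by (auto simp: \<XX>_plus_def \<XX>_def)

lemma keys_lin_ext: "Poly_Mapping.keys (lin_ext g p) \<subseteq> (\<Union>w\<in>Poly_Mapping.keys p. Poly_Mapping.keys (g w))"
proof
  fix v assume "v \<in> Poly_Mapping.keys (lin_ext g p)"
  then have "(\<Sum>w\<in>Poly_Mapping.keys p. Poly_Mapping.lookup p w * Poly_Mapping.lookup (g w) v) \<noteq> 0"
    by (simp add: lin_ext_def in_keys_iff lookup_sum lookup_scale)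
  then obtain w where "w \<in> Poly_Mapping.keys p" "Poly_Mapping.lookup p w * Poly_Mapping.lookup (g w) v \<noteq> 0"
    by (meson sum.not_neutral_contains_not_neutral)
  then show "v \<in> (\<Union>w\<in>Poly_Mapping.keys p. Poly_Mapping.keys (g w))"
    by (auto simp: in_keys_iff)
qed

lemma \<XX>_plus_letter:
  assumes "p \<in> \<XX>" "1 \<le> a"
  shows "word [a] * p \<in> \<XX>_plus"
  using assms Poly_Mapping.keys_mult[of "word [a]" p]
  by (fastforce simp: \<XX>_plus_iff \<XX>_def keys_word plus_list_def)

lemma \<XX>_plus_shift: "p \<in> \<XX> \<Longrightarrow> shift k p \<in> \<XX>_plus"
proof -
  assume p: "p \<in> \<XX>"
  have "Poly_Mapping.keys (shift_word k w) \<subseteq> {w. w \<noteq> [] \<and> (\<forall>b\<in>set w. 1 \<le> b)}"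
    if "\<forall>b\<in>set w. 1 \<le> b" for w
    using that by (cases w) (auto simp: keys_word)
  then show ?thesis
    using p keys_lin_ext[of "shift_word k" p] unfolding \<XX>_plus_iff shift_def \<XX>_def
    by blast
qed

lemma \<XX>_plus_add: "p \<in> \<XX>_plus \<Longrightarrow> q \<in> \<XX>_plus \<Longrightarrow> p + q \<in> \<XX>_plus"
  using Poly_Mapping.keys_add[of p q] unfolding \<XX>_plus_iff by blast

lemma \<XX>_plus_diff: "p \<in> \<XX>_plus \<Longrightarrow> q \<in> \<XX>_plus \<Longrightarrow> p - q \<in> \<XX>_plus"
  using \<XX>_plus_add[of p "- q"] by (simp add: \<XX>_plus_iff)

text \<open>Membership in \<open>\<XX>_plus\<close> is what \<open>blocks_lin_shift\<close> asks of
  the third term of the product; membership in \<XX> lets \<open>B_map\<close> be replaced by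
  \<open>blocks_lin 0\<close>.\<close>

lemma block_shuffle_word_pos:
  assumes "\<forall>b\<in>set u. 1 \<le> b" "\<forall>b\<in>set v. 1 \<le> b"
  shows "block_shuffle_word u v \<in> \<XX>"
    and "u \<noteq> [] \<or> v \<noteq> [] \<Longrightarrow> block_shuffle_word u v \<in> \<XX>_plus"
proof -
  have "block_shuffle_word u v \<in> \<XX> \<and> (u \<noteq> [] \<or> v \<noteq> [] \<longrightarrow> block_shuffle_word u v \<in> \<XX>_plus)"
    using assms
  proof (induction u v rule: block_shuffle_word.induct)
    case (3 a u b v)
    then have "block_shuffle_word (a # u) (b # v) \<in> \<XX>_plus"
      by (auto intro!: \<XX>_plus_add \<XX>_plus_diff \<XX>_plus_letter \<XX>_plus_shift)
    then show ?case
      by (auto simp: \<XX>_plus_def)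
  qed (auto simp: \<XX>_plus_def \<XX>_def keys_word)
  then show "block_shuffle_word u v \<in> \<XX>"
    and "u \<noteq> [] \<or> v \<noteq> [] \<Longrightarrow> block_shuffle_word u v \<in> \<XX>_plus"
    by auto
qed

text \<open>The identity on words, for either first letter because the recursion flips it. By
  induction along the block shuffle, the three terms of \<open>tri_alt\<close> match x_a(u
  \<diamondop> x_b v), x_b(x_a u \<diamondop> v) and the shifted term.\<close>

lemma tri_ext_blocks:
  assumes "\<forall>b\<in>set u. 1 \<le> b" "\<forall>b\<in>set v. 1 \<le> b" "c \<in> {0, 1}"
  shows "tri_ext c u (blocks c v) = blocks_lin c (block_shuffle_word u v)"
  using assms
proof (induction u v arbitrary: c rule: block_shuffle_word.induct)
  case (1 u)
  then show ?case
    by (simp add: tri_ext_def blocks_lin_def lin_ext_word)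
next
  case (2 b v)
  have n: "blocks c (b # v) \<noteq> []"
    using 2 by (intro blocks_neq_Nil) simp
  then show ?case
    unfolding tri_ext_def blocks_lin_def using tri_Nil[OF n] by (simp add: lin_ext_word del: blocks.simps)
next
  case (3 a u b v)
  have pos: "1 \<le> a" "\<forall>b\<in>set u. 1 \<le> b" "1 \<le> b" "\<forall>b\<in>set v. 1 \<le> b"
    using 3 by auto
  have n: "blocks x (b # v) \<noteq> []" for x
    using pos by (intro blocks_neq_Nil) simp
  have fl: "flip (a - 1) (flip (b - 1) c) = flip (a + b - 2) c" "flip (a + b - 2) c = flip (a + b) c"
    using pos by (auto simp: flip_flip flip_def)
  have i1: "tri u (map (flip (a - 1)) (alt c b @ blocks (flip (b - 1) c) v))
     = blocks_lin (flip (a - 1) c) (block_shuffle_word u (b # v))"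
  proof -
    have "tri u (map (flip (a - 1)) (alt c b @ blocks (flip (b - 1) c) v))
        = tri_ext (flip (a - 1) c) u (blocks (flip (a - 1) c) (b # v))"
      using n by (simp only: blocks.simps(2)[symmetric] map_flip_blocks tri_ext_def if_False)
    also have "\<dots> = blocks_lin (flip (a - 1) c) (block_shuffle_word u (b # v))"
      by (rule "3.IH"(1)[OF pos(2) "3.prems"(2) flip_in[OF "3.prems"(3)]])
    finally show ?thesis .
  qed
  have i2: "tri_ext (flip (b - 1) c) (a # u) (blocks (flip (b - 1) c) v)
    = blocks_lin (flip (b - 1) c) (block_shuffle_word (a # u) v)"
    using "3.IH"(2)[of "flip (b - 1) c"] 3 flip_in[OF "3.prems"(3), of "b - 1"] by simp
  have i3: "word (alt c (a + b)) * tri_ext0 (flip (a + b - 2) c) u (map (flip (a - 1)) (blocks (flip (b - 1) c) v))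
     = blocks_lin c (shift (a + b) (block_shuffle_word u v))"
  \<comment> \<open>If both words are empty, both sides vanish: the value 0 of
    \<open>tri_ext0\<close> meets s_k(1) = 0.\<close>
  proof (cases "u = [] \<and> v = []")
    case True
    then show ?thesis
      by (simp add: tri_ext0_def shift_def lin_ext_word blocks_lin_def lin_ext_zero)
  next
    case False
    then have "tri_ext0 (flip (a + b - 2) c) u (blocks (flip (a + b - 2) c) v)
        = tri_ext (flip (a + b - 2) c) u (blocks (flip (a + b - 2) c) v)"
      using blocks_neq_Nil[of "hd v" _ "tl v"] pos(4) by (cases v) (auto simp: tri_ext0_def)
    also have "\<dots> = blocks_lin (flip (a + b - 2) c) (block_shuffle_word u v)"
      using "3.IH"(3)[of "flip (a + b - 2) c"] pos flip_in[OF "3.prems"(3)] by blast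
    finally show ?thesis
      using blocks_lin_shift[OF block_shuffle_word_pos(2)[OF pos(2,4)], of c "a + b"] False
      unfolding map_flip_blocks fl by simp
  qed
  have "tri_ext c (a # u) (blocks c (b # v)) = tri (a # u) (alt c b @ blocks (flip (b - 1) c) v)"
    using n[of c] by (simp only: tri_ext_def if_False blocks.simps(2))
  also have "\<dots> = blocks_lin c (block_shuffle_word (a # u) (b # v))"
    unfolding tri_alt[OF pos(1,2) "3.prems"(3) pos(3)] i1 i2 i3
    by (simp only: block_shuffle_word.simps blocks_lin_add blocks_lin_diff blocks_lin_letter)
  finally show ?case .
qed

section \<open>Block words and the letters c_i\<close>

lemma mem_cut_points_Cons:
  assumes "bs \<noteq> []"
  shows "x \<in> cut_points (b # bs) \<longleftrightarrow> x = b \<or> (\<exists>y\<in>cut_points bs. x = b + y)"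
proof
  assume "x \<in> cut_points (b # bs)"
  then obtain j where j: "x = sum_list (take j (b # bs))" "1 \<le> j" "j \<le> length bs"
    by (auto simp: cut_points_def)
  then obtain j' where j': "j = Suc j'" by (cases j) auto
  show "x = b \<or> (\<exists>y\<in>cut_points bs. x = b + y)"
  proof (cases "j' = 0")
    case False
    then have "sum_list (take j' bs) \<in> cut_points bs"
      using j j' by (auto simp: cut_points_def)
    then show ?thesis using j(1) j' by auto
  qed (use j j' in auto)
next
  assume "x = b \<or> (\<exists>y\<in>cut_points bs. x = b + y)"
  then show "x \<in> cut_points (b # bs)"
  proof
    assume "x = b"
    \<comment> \<open>Another block follows, so the end of the first one is a cut point; the end of
      the whole word is not.\<close>
    then have "x = sum_list (take 1 (b # bs))" "1 \<le> length (b # bs) - 1"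
      using assms by (auto simp: Suc_le_eq)
    then show ?thesis unfolding cut_points_def by blast
  next
    assume "\<exists>y\<in>cut_points bs. x = b + y"
    then obtain j where "x = b + sum_list (take j bs)" "1 \<le> j" "j \<le> length bs - 1"
      by (auto simp: cut_points_def)
    then have "x = sum_list (take (Suc j) (b # bs))" "1 \<le> Suc j" "Suc j \<le> length (b # bs) - 1"
      by auto
    then show ?thesis unfolding cut_points_def by blast
  qed
qed

lemma cut_points_single: "cut_points [b] = {}"
  by (auto simp: cut_points_def)

lemma nth_alt: "i < n \<Longrightarrow> alt c n ! i = flip i c"
  by (simp add: alt_conv_upt)

lemma nth_blocks_0: "0 < b \<Longrightarrow> blocks c (b # bs) ! 0 = c"
  by (cases b) auto

text \<open>Inside the first block letters alternate, its last letter is repeated by the next block,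
  and later positions are those of the remaining blocks shifted by b.\<close>

lemma nth_blocks_Suc:
  assumes "\<forall>b\<in>set bs. 1 \<le> b" "Suc i < sum_list bs"
  shows "blocks c bs ! Suc i = (if Suc i \<in> cut_points bs then blocks c bs ! i else 1 - blocks c bs ! i)"
  using assms
proof (induction bs arbitrary: c i)
  case (Cons b bs)
  have b: "1 \<le> b" and pos: "\<forall>b\<in>set bs. 1 \<le> b"
    using Cons.prems by auto
  consider "Suc i < b" | "Suc i = b" | "b < Suc i" by linarith
  then show ?case
  proof cases
    case 1
    then have "Suc i \<notin> cut_points (b # bs)"
      by (cases "bs = []") (auto simp: cut_points_single mem_cut_points_Cons)
    then show ?thesis
      using 1 by (simp add: nth_append nth_alt flip_Suc)
  next
    case 2
    then obtain b' bs' where bs: "bs = b' # bs'"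
      using Cons.prems by (cases bs) auto
    then have "Suc i \<in> cut_points (b # bs)"
      using 2 by (simp add: mem_cut_points_Cons)
    moreover have "blocks (flip (b - 1) c) bs ! 0 = flip (b - 1) c"
      using pos nth_blocks_0[of b'] by (simp add: bs del: blocks.simps)
    ultimately show ?thesis
      using 2 b by (auto simp: nth_append nth_alt)
  next
    case 3
    then obtain k where k: "i = b + k"
      by (metis less_Suc_eq_le nat_le_iff_add)
    have ne: "bs \<noteq> []" using Cons.prems 3 by auto
    have "Suc i \<in> cut_points (b # bs) \<longleftrightarrow> Suc k \<in> cut_points bs"
      using mem_cut_points_Cons[OF ne, of "Suc i" b] by (auto simp: k)
    then show ?thesis
      using Cons.IH[OF pos, of k "flip (b - 1) c"] Cons.prems(2) by (simp add: nth_append k)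
  qed
qed simp

lemma blocks_block_letter:
  assumes "\<forall>b\<in>set bs. 1 \<le> b"
  shows "map (block_letter bs) [1..<sum_list bs + 1] = blocks 0 bs"
proof -
  have "block_letter bs (Suc i) = blocks 0 bs ! i" if "i < sum_list bs" for i
    using that
  proof (induction i)
    case 0
    then obtain b bs' where "bs = b # bs'" by (cases bs) auto
    then show ?case using assms nth_blocks_0[of b] by (simp del: blocks.simps)
  next
    case (Suc i)
    then show ?case using nth_blocks_Suc[OF assms Suc.prems] by simp
  qed
  moreover have "[1..<sum_list bs + 1] = map Suc [0..<sum_list bs]"
    by (simp add: map_Suc_upt del: upt_Suc)
  ultimately have "map (block_letter bs) [1..<sum_list bs + 1] = map (\<lambda>i. blocks 0 bs ! i) [0..<sum_list bs]"
    by simp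
  also have "\<dots> = blocks 0 bs"
    by (metis length_blocks map_nth)
  finally show ?thesis .
qed

section \<open>Extension from words to linear combinations\<close>

theorem theorem3p8:
  fixes u v :: "nat free_alg"
  assumes "u \<in> \<XX>" and "v \<in> \<XX>_plus"
  shows "u \<triangleright> B_map v = B_map (u \<diamondop> v)"
proof -
  have B: "word (map (block_letter bs) [1..<sum_list bs + 1]) = word (blocks 0 bs)"
    if "\<forall>b\<in>set bs. 1 \<le> b" for bs
    using blocks_block_letter[OF that] by simp
  have B_lin: "B_map p = blocks_lin 0 p" if "p \<in> \<XX>" for p
    unfolding B_map_def blocks_lin_def
    by (rule lin_ext_cong) (use that B in \<open>auto simp: \<XX>_def\<close>)
  have "u \<triangleright> B_map v = lin_ext (\<lambda>x. lin_ext (\<lambda>y. triangle_word x (map (block_letter y) [1..<sum_list y + 1])) v) u"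
    by (simp add: triangle_def bilin_ext_def B_map_def lin_ext_lin_ext lin_ext_word)
  also have "\<dots> = lin_ext (\<lambda>x. lin_ext (\<lambda>y. B_map (block_shuffle_word x y)) v) u"
  proof (intro lin_ext_cong)
    fix x y assume x: "x \<in> Poly_Mapping.keys u" and y: "y \<in> Poly_Mapping.keys v"
    have pos: "\<forall>b\<in>set x. 1 \<le> b" "\<forall>b\<in>set y. 1 \<le> b" and "y \<noteq> []"
      using x y assms by (auto simp: \<XX>_plus_def \<XX>_def)
    then have n: "blocks 0 y \<noteq> []"
      using blocks_neq_Nil by (cases y) auto
    \<comment> \<open>The block word of y is nonempty, so \<open>tri_ext\<close> is here
      \<open>triangle_word\<close> itself.\<close>
    then have "triangle_word x (blocks 0 y) = blocks_lin 0 (block_shuffle_word x y)"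
      using tri_ext_blocks[OF pos, of 0] by (simp add: tri_ext_def tri_def)
    then show "triangle_word x (map (block_letter y) [1..<sum_list y + 1]) = B_map (block_shuffle_word x y)"
      using blocks_block_letter[OF pos(2)] B_lin[OF block_shuffle_word_pos(1)[OF pos]] by simp
  qed
  also have "\<dots> = B_map (u \<diamondop> v)"
    by (simp add: block_shuffle_def bilin_ext_def B_map_def lin_ext_lin_ext)
  finally show ?thesis .
qed

end
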